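(* Let $n=p_1^{n_1}p_2^{n_2}\cdots p_r^{n_r}$, where $p_1<\cdots<p_r$ are primes and $n_i$ positive integers. Assume $r\in\{4,5\}$, $n_r=1$ and $2\phi(p_1p_2\cdots p_{r-1})<p_1p_2\cdots p_{r-1}$, and let $X$ be a minimum cut-set of $\mathcal{P}(C_n)$. Then $p_1\in\{2,3\}$ and: (i) If $r=4$, then $X\in\{Z_3^{n_3},Z_4^1\}$ and so $\kappa(\mathcal{P}(C_n))\in\{\beta_3^{n_3},\beta_4^1\}$. Furthermore, if $n_3=1$, then $X=Z_4^1$ and $\kappa(\mathcal{P}(C_n))=\beta_4^1$. (ii) If $r=5$ and $p_1=3$, then $X\in\{Z_4^{n_4},Z_5^1\}$ and so $\kappa(\mathcal{P}(C_n))\in\{\beta_4^{n_4},\beta_5^1\}$. Furthermore, if $n_4=1$, then $X=Z_5^1$ and $\kappa(\mathcal{P}(C_n))=\beta_5^1$.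
   Context: $[m]=\{1,\dots,m\}$, $\phi$ is Euler's totient function, $C_n$ is the cyclic group of order $n$. The power graph $\mathcal{P}(C_n)$ has vertex set $C_n$, two distinct vertices adjacent iff one is a power of the other. A cut-set is a vertex subset whose removal leaves a disconnected induced subgraph; a minimum cut-set is one of least size; $\kappa$ denotes vertex connectivity. For $d\mid n$, $E_d$ is the set of elements of order $d$ in $C_n$ and $S_d$ the subgroup of order $d$. For $a\in[r]$, $s\in[n_a]$: $Q_a^s=\bigcup_{i\in[r]\setminus\{a\}} S_{n/(p_ip_a^s)}$, $Z_a^s:=E_n\cup E_{n/p_a}\cup\cdots\cup E_{n/p_a^{s-1}}\cup Q_a^s$, and $$\beta_a^s:=\phi(n)+\frac{n}{p_1\cdots p_r}\cdot\frac{1}{p_a^{s-1}}\left[\frac{p_1\cdots p_r}{p_a}+\phi\left(\frac{p_1\cdots p_r}{p_a}\right)(p_a^{s-1}-2)\right].$$ *)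

theory Defs
  imports
    "HOL-Algebra.Elementary_Groups"
    "HOL-Algebra.Multiplicative_Group"
    "HOL-Number_Theory.Totient"
    "Graph_Theory.Digraph_Component"
begin

(* An undirected simple graph is represented, as in the entry Graph_Theory, by a digraph whose
   arcs are ordered pairs of vertices, each edge contributing both orientations. *)
definition power_graph :: "('a, 'b) monoid_scheme \<Rightarrow> ('a, 'a \<times> 'a) pre_digraph" where
  "power_graph G = with_proj
     \<lparr> pverts = carrier G,
       parcs = {(x, y). x \<in> carrier G \<and> y \<in> carrier G \<and> x \<noteq> y \<and>
                 ((\<exists>k::nat. y = x [^]\<^bsub>G\<^esub> k) \<or> (\<exists>k::nat. x = y [^]\<^bsub>G\<^esub> k))} \<rparr>"

(* The library's predicate for connectedness is false for the graph without vertices, which must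
   not count as disconnected; hence the condition that some vertex survives. *)
definition cut_set :: "('a, 'c) pre_digraph \<Rightarrow> 'a set \<Rightarrow> bool" where
  "cut_set H X \<longleftrightarrow> X \<subseteq> verts H \<and> verts H - X \<noteq> {} \<and>
     \<not> Digraph_Component.connected (induce_subgraph H (verts H - X))"

definition minimum_cut_set :: "('a, 'c) pre_digraph \<Rightarrow> 'a set \<Rightarrow> bool" where
  "minimum_cut_set H X \<longleftrightarrow> cut_set H X \<and> (\<forall>Y. cut_set H Y \<longrightarrow> card X \<le> card Y)"

(* For finite graphs: the least number of vertices whose removal leaves a disconnected graph or
   a single vertex (the second alternative matters only for complete graphs). *)
definition vertex_connectivity :: "('a, 'c) pre_digraph \<Rightarrow> nat" where
  "vertex_connectivity H =
     (LEAST k. \<exists>X\<subseteq>verts H. card X = k \<and> (cut_set H X \<or> card (verts H - X) = 1))"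

definition E_set :: "('a, 'b) monoid_scheme \<Rightarrow> nat \<Rightarrow> 'a set" where
  "E_set G d = {x \<in> carrier G. group.ord G x = d}"

(* Well defined for cyclic G and d dividing the order of G. *)
definition S_set :: "('a, 'b) monoid_scheme \<Rightarrow> nat \<Rightarrow> 'a set" where
  "S_set G d = (THE H. subgroup H G \<and> card H = d)"

(* Below, n is the order of G, p lists its prime divisors as p 1, ..., p r, and 1 <= a <= r,
   1 <= s <= multiplicity of p a in n, so that all the divisions of natural numbers are exact. *)

definition Q_set :: "('a, 'b) monoid_scheme \<Rightarrow> (nat \<Rightarrow> nat) \<Rightarrow> nat \<Rightarrow> nat \<Rightarrow> nat \<Rightarrow> 'a set" where
  "Q_set G p r a s = (\<Union>i\<in>{1..r} - {a}. S_set G (order G div (p i * p a ^ s)))"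

definition Z_set :: "('a, 'b) monoid_scheme \<Rightarrow> (nat \<Rightarrow> nat) \<Rightarrow> nat \<Rightarrow> nat \<Rightarrow> nat \<Rightarrow> 'a set" where
  "Z_set G p r a s = (\<Union>j<s. E_set G (order G div p a ^ j)) \<union> Q_set G p r a s"

(* Real-valued because the factor p a ^ (s - 1) - 2 is negative for s = 1. *)
definition beta :: "nat \<Rightarrow> (nat \<Rightarrow> nat) \<Rightarrow> nat \<Rightarrow> nat \<Rightarrow> nat \<Rightarrow> real" where
  "beta n p r a s =
     real (totient n) +
     real n / real (\<Prod>i=1..r. p i) * (1 / real (p a) ^ (s - 1)) *
       (real (\<Prod>i=1..r. p i) / real (p a) +
        real (totient ((\<Prod>i=1..r. p i) div p a)) * (real (p a) ^ (s - 1) - 2))"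

end

theory Submission
  imports Defs
begin

text \<open>
  A minimal cut-set of the power graph consists of the elements whose order lies in both or in
  neither of two incomparable up-sets \<open>U\<close>, \<open>V\<close> of divisors of \<open>n\<close>. If \<open>u\<close>, \<open>v\<close> are the
  probabilities that the order of a random element lies in \<open>U\<close>, \<open>V\<close>, Harris' inequality bounds
  the relative size of the cut-set from below by \<open>1 - u - v + 2 u v\<close>. The cut-set \<open>Z_r^1\<close> has
  relative size below one half, so for a minimum one, up to symmetry, \<open>v < 1/2\<close>, and every
  \<open>b \<in> V - U\<close> yields a bound through \<open>u \<le> 1 - b/n\<close> and \<open>v \<ge> w\<close>, where \<open>w\<close> is the probability
  that the order is a multiple of \<open>b\<close>. If two distinct primes divide \<open>n/b\<close>, this bound exceeds
  the size of \<open>Z_r^1\<close>, or for twin primes in case \<open>(2, 3, p_3, p_3 + 2)\<close> that of \<open>Z_3^{n_3}\<close>. If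
  \<open>n/b\<close> is a power of \<open>p_a\<close>, optimality forces \<open>n/p_a^{n_a}\<close> into \<open>V\<close>, and the resulting bound
  is attained only by the \<open>Z_a^{n_a}\<close> with \<open>a \<ge> r - 1\<close>.
\<close>

section \<open>Correlation of monotone functions on divisors\<close>

definition up_set :: "nat \<Rightarrow> nat set \<Rightarrow> bool" where
  "up_set n U \<longleftrightarrow> U \<subseteq> {d. d dvd n} \<and> (\<forall>d\<in>U. \<forall>e. d dvd e \<longrightarrow> e dvd n \<longrightarrow> e \<in> U)"

definition dmono :: "nat \<Rightarrow> (nat \<Rightarrow> real) \<Rightarrow> bool" where
  "dmono n f \<longleftrightarrow> (\<forall>d e. d dvd e \<longrightarrow> e dvd n \<longrightarrow> f d \<le> f e)"

text \<open>This is \<open>n\<close> times the expectation of \<open>f\<close> at the order of a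
  uniform element of the cyclic group of order \<open>n\<close>.\<close>

definition totient_sum :: "nat \<Rightarrow> (nat \<Rightarrow> real) \<Rightarrow> real" where
  "totient_sum n f = (\<Sum>d | d dvd n. real (totient d) * f d)"

lemma totient_sum_const: "totient_sum n (\<lambda>_. c) = real n * c"
  by (simp add: totient_sum_def sum_distrib_right[symmetric] flip: of_nat_sum add: totient_divisor_sum)

lemma totient_sum_mono: "(\<And>d. d dvd n \<Longrightarrow> f d \<le> g d) \<Longrightarrow> totient_sum n f \<le> totient_sum n g"
  unfolding totient_sum_def by (intro sum_mono mult_left_mono) auto

lemma totient_sum_cmult: "totient_sum n (\<lambda>d. c * f d) = c * totient_sum n f"
  unfolding totient_sum_def by (simp add: sum_distrib_left mult_ac)

text \<open>Divisors of a coprime product factor uniquely and the totient is multiplicative, so the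
  sum splits like an integral over a product measure.\<close>

lemma totient_sum_mult_coprime:
  assumes "coprime a b" "a > 0" "b > 0"
  shows "totient_sum (a * b) f = totient_sum a (\<lambda>d. totient_sum b (\<lambda>e. f (d * e)))"
proof -
  have bij: "bij_betw (\<lambda>(d, e). d * e) ({d. d dvd a} \<times> {e. e dvd b}) {d. d dvd a * b}"
    unfolding bij_betw_def
  proof
    show "inj_on (\<lambda>(d, e). d * e) ({d. d dvd a} \<times> {e. e dvd b})"
    proof (rule inj_onI, clarify)
      fix d e d' e' assume *: "d dvd a" "e dvd b" "d' dvd a" "e' dvd b" "d * e = d' * e'"
      have "coprime d e'" "coprime d' e"
        using * assms(1) by (meson coprime_divisors)+
      then have "d dvd d'" "d' dvd d"
        using *(5) by (metis coprime_dvd_mult_left_iff dvd_triv_left)+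
      then have "d = d'" by (rule dvd_antisym)
      moreover have "d' > 0" using * assms by (auto intro: dvd_pos_nat)
      ultimately show "d = d' \<and> e = e'" using *(5) by auto
    qed
    show "(\<lambda>(d, e). d * e) ` ({d. d dvd a} \<times> {e. e dvd b}) = {d. d dvd a * b}"
    proof (intro equalityI subsetI)
      fix x assume "x \<in> {d. d dvd a * b}"
      then obtain d e where "x = d * e" "d dvd a" "e dvd b" by (auto elim: dvd_productE)
      then show "x \<in> (\<lambda>(d, e). d * e) ` ({d. d dvd a} \<times> {e. e dvd b})" by force
    qed (auto intro: mult_dvd_mono)
  qed
  have "totient_sum a (\<lambda>d. totient_sum b (\<lambda>e. f (d * e))) =
      (\<Sum>d | d dvd a. \<Sum>e | e dvd b. real (totient (d * e)) * f (d * e))"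
    unfolding totient_sum_def sum_distrib_left
  proof (intro sum.cong refl)
    fix d e assume "d \<in> {d. d dvd a}" "e \<in> {e. e dvd b}"
    then have "coprime d e" using assms(1) by (auto intro: coprime_divisors)
    then show "real (totient d) * (real (totient e) * f (d * e)) = real (totient (d * e)) * f (d * e)"
      by (simp add: totient_mult_coprime)
  qed
  also have "\<dots> = (\<Sum>(d, e) \<in> {d. d dvd a} \<times> {e. e dvd b}. real (totient (d * e)) * f (d * e))"
    by (simp add: sum.cartesian_product)
  also have "\<dots> = totient_sum (a * b) f"
    unfolding totient_sum_def using sum.reindex_bij_betw[OF bij, of "\<lambda>d. real (totient d) * f d"]
    by (simp add: case_prod_unfold)
  finally show ?thesis by simp
qed

text \<open>Divisors of a prime power form a chain, so \<open>f d - f e\<close> and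
  \<open>g d - g e\<close> never have opposite signs. Chebyshev's sum inequality follows by
  expanding the weighted double sum of their products.\<close>

lemma chebyshev_prime_power:
  assumes "prime p" "dmono (p ^ k) f" "dmono (p ^ k) g"
  shows "totient_sum (p ^ k) f * totient_sum (p ^ k) g \<le> real (p ^ k) * totient_sum (p ^ k) (\<lambda>d. f d * g d)"
proof -
  define D where "D = {d. d dvd p ^ k}"
  define w where "w d = real (totient d)" for d
  have "0 \<le> (\<Sum>d\<in>D. \<Sum>e\<in>D. w d * w e * ((f d - f e) * (g d - g e)))"
  proof (rule sum_nonneg, rule sum_nonneg, rule mult_nonneg_nonneg)
    fix d e assume "d \<in> D" "e \<in> D"
    then obtain i j where ij: "d = p ^ i" "i \<le> k" "e = p ^ j" "j \<le> k"
      using assms(1) by (auto simp: D_def divides_primepow_nat)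
    have le: "f (p ^ s) \<le> f (p ^ t)" "g (p ^ s) \<le> g (p ^ t)" if "s \<le> t" "t \<le> k" for s t
      using that assms(2,3) unfolding dmono_def by (auto simp: le_imp_power_dvd)
    have "i \<le> j \<or> j \<le> i" by auto
    then show "0 \<le> (f d - f e) * (g d - g e)"
      unfolding ij using le ij by (auto simp: zero_le_mult_iff)
  qed (auto simp: w_def)
  also have "\<dots> = (\<Sum>d\<in>D. \<Sum>e\<in>D. w d * f d * g d * w e) + (\<Sum>d\<in>D. \<Sum>e\<in>D. w d * (w e * f e * g e))
      - (\<Sum>d\<in>D. \<Sum>e\<in>D. (w d * f d) * (w e * g e)) - (\<Sum>d\<in>D. \<Sum>e\<in>D. (w d * g d) * (w e * f e))"
    by (simp add: algebra_simps sum.distrib sum_subtractf)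
  also have "\<dots> = 2 * ((\<Sum>d\<in>D. w d) * (\<Sum>d\<in>D. w d * f d * g d) - (\<Sum>d\<in>D. w d * f d) * (\<Sum>d\<in>D. w d * g d))"
    unfolding sum_product[symmetric] by simp
  finally have "(\<Sum>d\<in>D. w d * f d) * (\<Sum>d\<in>D. w d * g d) \<le> (\<Sum>d\<in>D. w d) * (\<Sum>d\<in>D. w d * f d * g d)"
    by simp
  moreover have "(\<Sum>d\<in>D. w d) = real (p ^ k)"
    using totient_sum_const[of "p ^ k" 1] by (simp add: totient_sum_def D_def w_def)
  ultimately show ?thesis by (simp add: totient_sum_def D_def w_def mult_ac)
qed

text \<open>Induction splitting off one full prime power: Chebyshev handles the prime-power
  coordinate, the induction hypothesis the slices over the coprime part.\<close>

lemma harris: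
  assumes "n > 0" "dmono n f" "dmono n g"
  shows "totient_sum n f * totient_sum n g \<le> real n * totient_sum n (\<lambda>d. f d * g d)"
  using assms
proof (induction n arbitrary: f g rule: less_induct)
  case (less n)
  show ?case
  proof (cases "n = 1")
    case True
    then show ?thesis by (simp add: totient_sum_def)
  next
    case False
    then obtain p where p: "prime p" "p dvd n" using prime_factor_nat by blast
    define k where "k = multiplicity p n"
    obtain m where n: "n = p ^ k * m" and "\<not> p dvd m"
      using multiplicity_decompose'[of n p] less.prems(1) p(1) k_def
      by (metis gr_implies_not0 not_prime_unit)
    then have cop: "coprime (p ^ k) m" using p(1) by (simp add: prime_imp_coprime)
    have pos: "p ^ k > 0" "m > 0" using less.prems(1) n by (auto intro: gr0I)
    have "k > 0" using p less.prems(1) by (simp add: k_def prime_multiplicity_gt_zero_iff)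
    then have "m < n" using n pos one_less_power[OF prime_gt_1_nat[OF p(1)]] by auto
    \<comment> \<open>\<open>F f d\<close> sums out the coprime coordinate and inherits monotonicity
      in \<open>d\<close>.\<close>
    define F where "F f = (\<lambda>d. totient_sum m (\<lambda>e. f (d * e)))" for f
    have sub: "dmono m (\<lambda>e. f (d * e))" if "d dvd p ^ k" "dmono n f" for d f
      using that unfolding dmono_def n by (auto intro: mult_dvd_mono)
    have mono: "dmono (p ^ k) (F f)" if "dmono n f" for f
      using that unfolding dmono_def F_def n by (auto intro!: totient_sum_mono mult_dvd_mono)
    have "totient_sum n f * totient_sum n g = totient_sum (p ^ k) (F f) * totient_sum (p ^ k) (F g)"
      unfolding n F_def using cop pos by (simp add: totient_sum_mult_coprime)
    also have "\<dots> \<le> real (p ^ k) * totient_sum (p ^ k) (\<lambda>d. F f d * F g d)"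
      by (intro chebyshev_prime_power p mono less.prems)
    also have "\<dots> \<le> real (p ^ k) * totient_sum (p ^ k) (\<lambda>d. real m * totient_sum m (\<lambda>e. f (d * e) * g (d * e)))"
      unfolding F_def
      by (intro mult_left_mono totient_sum_mono less.IH \<open>m < n\<close> pos sub less.prems) auto
    also have "\<dots> = real n * totient_sum n (\<lambda>d. f d * g d)"
      unfolding totient_sum_cmult using cop pos by (simp add: n totient_sum_mult_coprime)
    finally show ?thesis .
  qed
qed

text \<open>The order of a uniformly chosen element of the cyclic group of order \<open>n\<close> takes the value \<open>d\<close>
  with probability \<open>totient d / n\<close>.\<close>

definition prb :: "nat \<Rightarrow> nat set \<Rightarrow> real" where
  "prb n S = (\<Sum>d\<in>S. real (totient d)) / real n"

text \<open>Indicators of up-sets are monotone, and their product is the indicator of the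
  intersection.\<close>

lemma harris_up_sets:
  assumes "n > 0" "up_set n U" "up_set n V"
  shows "prb n U * prb n V \<le> prb n (U \<inter> V)"
proof -
  have eq: "totient_sum n (\<lambda>d. of_bool (d \<in> S)) = real n * prb n S" if "S \<subseteq> {d. d dvd n}" for S
    using that assms(1) unfolding totient_sum_def prb_def of_bool_def
    by (simp add: sum.inter_restrict[symmetric] if_distrib Int_absorb1 cong: if_cong)
  have dm: "dmono n (\<lambda>d. of_bool (d \<in> S))" if "up_set n S" for S
    using that unfolding dmono_def up_set_def by auto
  have "totient_sum n (\<lambda>d. of_bool (d \<in> U)) * totient_sum n (\<lambda>d. of_bool (d \<in> V)) \<le>
      real n * totient_sum n (\<lambda>d. of_bool (d \<in> U \<inter> V))"
    using harris[OF assms(1) dm[OF assms(2)] dm[OF assms(3)]] by (simp add: of_bool_conj)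
  moreover have "U \<subseteq> {d. d dvd n}" "V \<subseteq> {d. d dvd n}"
    using assms by (auto simp: up_set_def)
  ultimately have "(real n * real n) * (prb n U * prb n V) \<le> (real n * real n) * prb n (U \<inter> V)"
    using eq[of U] eq[of V] eq[of "U \<inter> V"] by (simp add: mult_ac le_infI1)
  then show ?thesis using assms(1) by simp
qed

section \<open>Inequalities between small primes\<close>

lemma prime_gap:
  fixes p q :: nat
  assumes "prime p" "prime q" "2 < p" "p < q"
  shows "p + 2 \<le> q"
proof -
  have "odd p" "odd q" using assms prime_odd_nat by auto
  then have "q \<noteq> Suc p" by auto
  with assms(4) show ?thesis by auto
qed

lemma one_minus_inverse_mono: "0 < (k::real) \<Longrightarrow> k \<le> q \<Longrightarrow> 1 - 1 / k \<le> 1 - 1 / q"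
  by (simp add: frac_le)

lemma not_prime_4: "\<not> prime (4 :: nat)"
  by (simp add: prime_nat_iff') (auto intro: bexI[of _ 2])

text \<open>For \<open>a \<ge> 5\<close> the factors are at least 4/5, 5/6, 6/7, 7/8; the products
  telescope to 4/7 for three factors and 1/2 for four.\<close>

lemma smallest_prime_bound:
  fixes a b c d :: nat
  assumes "prime a" "a < b" "b < c"
    "(1 - 1 / real a) * (1 - 1 / real b) * (1 - 1 / real c) < 1 / 2 \<or>
     c < d \<and> (1 - 1 / real a) * (1 - 1 / real b) * (1 - 1 / real c) * (1 - 1 / real d) < 1 / 2"
  shows "a \<in> {2, 3}"
proof (rule ccontr)
  assume not: "a \<notin> {2, 3}"
  have "a \<noteq> 4" using assms(1) not_prime_4 by auto
  then have "a \<ge> 5" using not prime_ge_2_nat[OF assms(1)] by auto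
  then have *: "4 / 5 \<le> 1 - 1 / real a" "5 / 6 \<le> 1 - 1 / real b" "6 / 7 \<le> 1 - 1 / real c"
    "c < d \<Longrightarrow> 7 / 8 \<le> 1 - 1 / real d"
    using assms one_minus_inverse_mono[of 5 "real a"] one_minus_inverse_mono[of 6 "real b"]
      one_minus_inverse_mono[of 7 "real c"] one_minus_inverse_mono[of 8 "real d"] by auto
  have "4 / 5 * (5 / 6) * (6 / 7) \<le> (1 - 1 / real a) * (1 - 1 / real b) * (1 - 1 / real c)"
    using * by (intro mult_mono) auto
  moreover have "4 / 5 * (5 / 6) * (6 / 7) * (7 / 8) \<le>
      (1 - 1 / real a) * (1 - 1 / real b) * (1 - 1 / real c) * (1 - 1 / real d)" if "c < d"
    using * that by (intro mult_mono mult_nonneg_nonneg) auto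
  ultimately show False using assms(4) by auto
qed

text \<open>\<open>T\<close> stands for the product of \<open>1 - 1 / p i\<close> over the primes
  other than \<open>p\<close> and the last prime \<open>q\<close>. The left side is then the cut
  value of \<open>q\<close> with exponent one, the right side the ratio omitting
  \<open>p\<close>.\<close>

lemma second_last_bound:
  fixes T p q :: real
  assumes "0 < p" "0 < q" "p \<le> T * (q + p - 2)"
  shows "T * (1 - 1 / p) + 1 / q * (1 - 2 * (T * (1 - 1 / p))) \<le> T * (1 - 1 / q)"
proof -
  have "T * (1 - 1 / q) - (T * (1 - 1 / p) + 1 / q * (1 - 2 * (T * (1 - 1 / p))))
      = (T * (q + p - 2) - p) / (p * q)"
    using assms by (simp add: field_simps)
  also have "\<dots> \<ge> 0" using assms by simp
  finally show ?thesis by simp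
qed

text \<open>Supplies the hypothesis of \<open>second_last_bound\<close> for four primes, with
  \<open>b\<close> and \<open>d\<close> as \<open>p\<close> and \<open>q\<close>. For
  \<open>a = 2\<close> the gaps between odd primes are needed sharply; for \<open>a = 3\<close> the
  estimate \<open>c \<ge> 5\<close> gives enough room.\<close>

lemma gap_bound_4:
  fixes a b c d :: nat
  assumes "prime b" "prime c" "prime d" "a \<in> {2, 3}" "a < b" "b < c" "c < d"
  shows "real b \<le> (1 - 1 / real a) * (1 - 1 / real c) * (real d + real b - 2)"
proof -
  have gaps: "b + 2 \<le> c" "c + 2 \<le> d"
    using assms prime_gap[of b c] prime_gap[of c d] by auto
  have c: "real c > 0" using assms by simp
  show ?thesis
  proof (cases "a = 2")
    case True
    \<comment> \<open>After this substitution the difference of the two sides below is a polynomial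
      in \<open>b\<close> and \<open>i\<close> with nonnegative coefficients.\<close>
    obtain i where i: "c = b + 2 + i" using gaps(1) le_Suc_ex by blast
    have "2 * real b * real c \<le> (real c - 1) * (real c + real b)"
      unfolding i using assms by (simp add: algebra_simps)
    also have "\<dots> \<le> (real c - 1) * (real d + real b - 2)"
      using gaps assms by (intro mult_left_mono) auto
    finally have "real b * (2 * real c) \<le> (real c - 1) * (real d + real b - 2)" by simp
    then have "real b \<le> (real c - 1) * (real d + real b - 2) / (2 * real c)"
      using c by (subst pos_le_divide_eq) auto
    also have "\<dots> = (1 - 1 / real a) * (1 - 1 / real c) * (real d + real b - 2)"
      using c True by (simp add: field_simps)
    finally show ?thesis .
  next
    case False
    then have "a = 3" using assms by auto
    have "4 / 5 \<le> 1 - 1 / real c"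
      using one_minus_inverse_mono[of 5 "real c"] assms \<open>a = 3\<close> by auto
    then have "2 / 3 * (4 / 5) * (2 * real b) \<le> (1 - 1 / real a) * (1 - 1 / real c) * (real d + real b - 2)"
      using gaps \<open>a = 3\<close> \<open>4 / 5 \<le> 1 - 1 / real c\<close>
      by (intro mult_mono mult_nonneg_nonneg) auto
    then show ?thesis using of_nat_0_le_iff[of b] by linarith
  qed
qed

text \<open>The analogue for five primes starting with 3, with \<open>c\<close> and \<open>e\<close>
  as \<open>p\<close> and \<open>q\<close>. The estimates \<open>b \<ge> 5\<close>,
  \<open>d \<ge> c + 2\<close> and \<open>e \<ge> c + 4\<close> reduce it to
  \<open>15 * c * (c + 2) \<le> 16 * (c + 1)^2\<close>.\<close>

lemma gap_bound_5:
  fixes b c d e :: nat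
  assumes "prime b" "prime c" "prime d" "prime e" "3 < b" "b < c" "c < d" "d < e"
  shows "real c \<le> (1 - 1 / 3) * (1 - 1 / real b) * (1 - 1 / real d) * (real e + real c - 2)"
proof -
  have "prime (3::nat)" by simp
  then have gaps: "5 \<le> b" "c + 2 \<le> d" "d + 2 \<le> e"
    using assms prime_gap[of 3 b] prime_gap[of c d] prime_gap[of d e] by auto
  define D where "D = real c + 2"
  have D: "D > 0" by (simp add: D_def)
  have "4 / 5 \<le> 1 - 1 / real b" using one_minus_inverse_mono[of 5 "real b"] gaps by auto
  moreover have "1 - 1 / D \<le> 1 - 1 / real d"
    using one_minus_inverse_mono[of D "real d"] gaps D by (auto simp: D_def)
  moreover have "0 \<le> 1 - 1 / D" by (simp add: D_def)
  ultimately have "2 / 3 * (4 / 5) * (1 - 1 / D) * (2 * real c + 2) \<le>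
      (1 - 1 / 3) * (1 - 1 / real b) * (1 - 1 / real d) * (real e + real c - 2)"
    using gaps by (intro mult_mono mult_nonneg_nonneg) auto
  moreover have "real c \<le> 2 / 3 * (4 / 5) * (1 - 1 / D) * (2 * real c + 2)"
    using D by (simp add: field_simps) (simp add: D_def algebra_simps)
  ultimately show ?thesis by linarith
qed

text \<open>Extremal values are \<open>1/2 * 4/5 * 5/6\<close> and
  \<open>2/3 * 3/4 * 4/5 * 5/6\<close>, both equal to 1/3, the threshold of
  \<open>last_factor_bound\<close>. Among primes the excluded case starts with 2, 3.\<close>

lemma third_bound:
  fixes a b c d :: nat
  assumes "a < b" "b < c" "2 \<le> a"
  shows "\<not> (a = 2 \<and> b \<le> 4) \<Longrightarrow> 1 / 3 \<le> (1 - 1 / real a) * (1 - 1 / real b) * (1 - 1 / real c)"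
    and "a = 3 \<Longrightarrow> c < d \<Longrightarrow>
      1 / 3 \<le> (1 - 1 / real a) * (1 - 1 / real b) * (1 - 1 / real c) * (1 - 1 / real d)"
proof -
  assume *: "\<not> (a = 2 \<and> b \<le> 4)"
  show "1 / 3 \<le> (1 - 1 / real a) * (1 - 1 / real b) * (1 - 1 / real c)"
  proof (cases "a = 2")
    case True
    have "1 / 2 * (4 / 5) * (5 / 6) \<le> (1 - 1 / real a) * (1 - 1 / real b) * (1 - 1 / real c)"
      using True * assms one_minus_inverse_mono[of 5 "real b"] one_minus_inverse_mono[of 6 "real c"]
      by (intro mult_mono mult_nonneg_nonneg) auto
    then show ?thesis by simp
  next
    case False
    have "2 / 3 * (3 / 4) * (4 / 5) \<le> (1 - 1 / real a) * (1 - 1 / real b) * (1 - 1 / real c)"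
      using False * assms one_minus_inverse_mono[of 3 "real a"] one_minus_inverse_mono[of 4 "real b"]
        one_minus_inverse_mono[of 5 "real c"]
      by (intro mult_mono mult_nonneg_nonneg) auto
    then show ?thesis by simp
  qed
next
  assume *: "a = 3" "c < d"
  have "2 / 3 * (3 / 4) * (4 / 5) * (5 / 6) \<le>
      (1 - 1 / real a) * (1 - 1 / real b) * (1 - 1 / real c) * (1 - 1 / real d)"
    using * assms one_minus_inverse_mono[of 4 "real b"] one_minus_inverse_mono[of 5 "real c"]
      one_minus_inverse_mono[of 6 "real d"]
    by (intro mult_mono mult_nonneg_nonneg) auto
  then show "1 / 3 \<le> (1 - 1 / real a) * (1 - 1 / real b) * (1 - 1 / real c) * (1 - 1 / real d)"
    by simp
qed

text \<open>From 1/3 on, \<open>1 - 2 * c \<le> c\<close>. Used with \<open>y = 1 / p r\<close> and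
  \<open>x = 1 / p j\<close>, so that the left side is the cut value of the last prime.\<close>

lemma last_factor_bound:
  fixes x y c :: real
  assumes "1 / 3 \<le> c" "0 \<le> y" "y \<le> x"
  shows "c + y * (1 - 2 * c) \<le> c * (1 + x)"
proof -
  have "y * (1 - 2 * c) \<le> y * c" using assms by (intro mult_left_mono) auto
  also have "\<dots> \<le> x * c" using assms by (intro mult_right_mono) auto
  finally show ?thesis by (simp add: algebra_simps)
qed

text \<open>Treats the primes 2, 3, \<open>c\<close>, \<open>d\<close>, where the ratio
  \<open>C\<close> falls below 1/3. The first three left sides are the cut value of
  \<open>d\<close>. Twin primes violate the third comparison; there the cut value of
  \<open>c\<close> with exponent \<open>k\<close> takes over.\<close>

lemma bound_2_3:
  fixes c d :: nat
  assumes "prime c" "prime d" "3 < c" "c < d"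
  defines "C \<equiv> 1 / 3 * (1 - 1 / real c)"
  shows "C + 1 / real d * (1 - 2 * C) \<le> 1 / 3"
    and "C + 1 / real d * (1 - 2 * C) \<le> C * (1 + 1 / 3)"
    and "d \<noteq> c + 2 \<Longrightarrow> C + 1 / real d * (1 - 2 * C) \<le> C * (1 + 1 / real c)"
    and "d = c + 2 \<Longrightarrow> 2 \<le> k \<Longrightarrow> (1 / real c) ^ k + (1 - 2 * (1 / real c) ^ k) * (1 / 3 * (1 - 1 / real d))
      \<le> C * (1 + 1 / real c)"
proof -
  have "prime (3::nat)" by simp
  then have gaps: "5 \<le> c" "c + 2 \<le> d"
    using assms prime_gap[of 3 c] prime_gap[of c d] by auto
  have pos: "real c > 0" "real d > 0" using gaps by auto
  have eq: "C + 1 / real d * (1 - 2 * C) = (real c * real d - real d + real c + 2) / (3 * real c * real d)"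
    using pos by (simp add: C_def field_simps)
  show "C + 1 / real d * (1 - 2 * C) \<le> 1 / 3"
    unfolding eq using pos gaps by (simp add: field_simps)
  \<comment> \<open>The substitutions for \<open>c\<close> and \<open>d\<close> leave a polynomial
    comparison with nonnegative coefficients.\<close>
  obtain i where i: "c = 5 + i" using gaps(1) le_Suc_ex by blast
  obtain j where j: "d = c + 2 + j" using gaps(2) le_Suc_ex by blast
  have "C * (1 + 1 / 3) = (4 * real c * real d - 4 * real d) / (9 * real c * real d)"
    using pos by (simp add: C_def field_simps)
  moreover have "3 * (real c * real d - real d + real c + 2) \<le> 4 * real c * real d - 4 * real d"
    unfolding j i by (simp add: algebra_simps)
  ultimately show "C + 1 / real d * (1 - 2 * C) \<le> C * (1 + 1 / 3)"
    unfolding eq using pos by (simp add: field_simps)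
  have C: "C * (1 + 1 / real c) = (real c * real c - 1) / (3 * real c * real c)"
    using pos by (simp add: C_def field_simps)
  show "C + 1 / real d * (1 - 2 * C) \<le> C * (1 + 1 / real c)" if "d \<noteq> c + 2"
  proof -
    \<comment> \<open>Parity excludes \<open>c + 3\<close> as well, so primes that are not twins
      differ by at least four.\<close>
    have "odd c" "odd d" using assms prime_odd_nat by auto
    then have "d \<noteq> c + 3" by auto
    then have "c + 4 \<le> d" using that gaps(2) by linarith
    then obtain k where k: "d = c + 4 + k" using le_Suc_ex by blast
    have "(real c * real d - real d + real c + 2) * real c \<le> (real c * real c - 1) * real d"
      unfolding k i by (simp add: algebra_simps)
    then have "(real c * real d - real d + real c + 2) * real c / (3 * real c * real c * real d) \<le>
        (real c * real c - 1) * real d / (3 * real c * real c * real d)"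
      by (intro divide_right_mono) auto
    then show ?thesis unfolding eq C using pos by simp
  qed
  assume d: "d = c + 2" and k: "2 \<le> k"
  define w where "w = 1 / 3 * (1 - 1 / real d)"
  \<comment> \<open>Hence the value does not increase with the exponent, and only
    \<open>k = 2\<close> has to be checked.\<close>
  have w: "0 \<le> 1 - 2 * w" using pos by (simp add: w_def field_simps)
  have "(1 / real c) ^ k \<le> (1 / real c) ^ 2"
    using k gaps by (intro power_decreasing) auto
  then have "(1 / real c) ^ k * (1 - 2 * w) + w \<le> (1 / real c) ^ 2 * (1 - 2 * w) + w"
    using w by (simp add: mult_right_mono)
  also have "\<dots> \<le> C * (1 + 1 / real c)"
  proof -
    have "(1 / real c) ^ 2 * (1 - 2 * w) + w =
        ((real d + 2) + (real d - 1) * real c * real c) / (3 * real c * real c * real d)"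
      using pos by (simp add: w_def field_simps power2_eq_square)
    moreover have "(real d + 2) + (real d - 1) * real c * real c \<le> (real c * real c - 1) * real d"
      unfolding d i by (simp add: algebra_simps)
    ultimately have "(1 / real c) ^ 2 * (1 - 2 * w) + w \<le>
        (real c * real c - 1) * real d / (3 * real c * real c * real d)"
      by (metis divide_right_mono of_nat_0_le_iff zero_le_mult_iff zero_le_numeral)
    then show ?thesis unfolding C using pos by simp
  qed
  finally show "(1 / real c) ^ k + (1 - 2 * (1 / real c) ^ k) * (1 / 3 * (1 - 1 / real d))
      \<le> C * (1 + 1 / real c)"
    by (simp add: w_def algebra_simps)
qed

section \<open>Pairs of incomparable up-sets\<close>

lemma finite_up_set: "up_set n U \<Longrightarrow> n > 0 \<Longrightarrow> finite U"
  unfolding up_set_def by (auto intro: finite_subset)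

lemma prb_mono: "finite T \<Longrightarrow> S \<subseteq> T \<Longrightarrow> prb n S \<le> prb n T"
  unfolding prb_def by (intro divide_right_mono sum_mono2) auto

lemma prb_Un_disjoint:
  "finite S \<Longrightarrow> finite T \<Longrightarrow> S \<inter> T = {} \<Longrightarrow> prb n (S \<union> T) = prb n S + prb n T"
  by (simp add: prb_def sum.union_disjoint add_divide_distrib)

lemma prb_Diff: "finite S \<Longrightarrow> prb n (S - T) = prb n S - prb n (S \<inter> T)"
proof -
  assume "finite S"
  moreover have "(S - T) \<inter> (S \<inter> T) = {}" by auto
  ultimately show ?thesis using prb_Un_disjoint[of "S - T" "S \<inter> T" n] by (simp add: Un_Diff_Int)
qed

text \<open>Totients of positive numbers are positive, so omitting any element costs probability.
  This turns equality in the estimates into equality of sets.\<close>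

lemma prb_eq_imp_eq:
  assumes "finite T" "S \<subseteq> T" "\<And>d. d \<in> T \<Longrightarrow> d > 0" "n > 0" "prb n T \<le> prb n S"
  shows "S = T"
proof (rule ccontr)
  assume "S \<noteq> T"
  then obtain d where d: "d \<in> T - S" using assms(2) by auto
  have "prb n S < prb n (insert d S)"
    unfolding prb_def using d assms finite_subset[OF assms(2,1)]
    by (intro divide_strict_right_mono) auto
  also have "\<dots> \<le> prb n T" using d assms by (intro prb_mono) auto
  finally show False using assms(5) by simp
qed

lemma prb_divisors: "n > 0 \<Longrightarrow> prb n {d. d dvd b} = real b / real n"
  unfolding prb_def by (simp flip: of_nat_sum add: totient_divisor_sum)

section \<open>Principal up-sets of the divisor lattice\<close>

definition cone :: "nat \<Rightarrow> nat \<Rightarrow> nat set" where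
  "cone n b = {d. d dvd n \<and> b dvd d}"

lemma up_set_cone: "up_set n (cone n b)"
  unfolding up_set_def cone_def by (auto intro: dvd_trans)

lemma up_set_non_divisors: "up_set n {d. d dvd n \<and> \<not> d dvd b}"
  unfolding up_set_def by (auto intro: dvd_trans)

lemma up_set_Un: "up_set n U \<Longrightarrow> up_set n V \<Longrightarrow> up_set n (U \<union> V)"
  unfolding up_set_def by blast

lemma cone_subset: "up_set n V \<Longrightarrow> b \<in> V \<Longrightarrow> cone n b \<subseteq> V"
  unfolding up_set_def cone_def by blast

text \<open>The cone consists of the \<open>M * d\<close> with \<open>d\<close> dividing
  \<open>q\<close>; the totient factors, and the totients of the divisors of \<open>q\<close> sum to
  \<open>q\<close>.\<close>

lemma prb_cone_coprime:
  assumes "coprime M q" "M > 0" "q > 0"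
  shows "prb (M * q) (cone (M * q) M) = totient M / M"
proof -
  have "cone (M * q) M = (\<lambda>d. M * d) ` {d. d dvd q}"
    using assms by (auto simp: cone_def image_iff elim!: dvdE[of M])
  moreover have "inj_on (\<lambda>d. M * d) {d. d dvd q}" using assms by (auto simp: inj_on_def)
  moreover have "totient (M * d) = totient M * totient d" if "d dvd q" for d
    using that assms by (intro totient_mult_coprime) (meson coprime_divisors dvd_refl)
  ultimately have "(\<Sum>d\<in>cone (M * q) M. real (totient d)) = (\<Sum>d | d dvd q. real (totient M) * real (totient d))"
    by (simp add: sum.reindex)
  also have "\<dots> = real (totient M) * real q"
    by (simp flip: sum_distrib_left of_nat_sum add: totient_divisor_sum)
  finally show ?thesis using assms by (simp add: prb_def)
qed

text \<open>The quotient is \<open>p\<close> if \<open>p\<close> divides \<open>n\<close> and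
  \<open>p - 1\<close> otherwise.\<close>

lemma totient_prime_mult_le:
  assumes "prime (p::nat)"
  shows "totient (p * n) \<le> p * totient n"
proof (cases "p dvd n")
  case True
  then have "gcd p n = p" by (simp add: gcd_nat.absorb1)
  then show ?thesis
    using totient_gcd[of p n] assms prime_gt_0_nat[OF assms] by simp
next
  case False
  then have "coprime p n" using assms by (simp add: prime_imp_coprime)
  then show ?thesis using totient_le[of p] by (simp add: totient_mult_coprime)
qed

text \<open>Only \<open>n\<close>, \<open>q * b\<close>, \<open>p * b\<close> and \<open>b\<close>
  are counted, with \<open>totient_prime_mult_le\<close> bounding the smaller ones. The first form
  keeps the weight of \<open>p * b\<close> exact and serves when \<open>q\<close> is the last
  prime.\<close>

lemma prb_cone_two_primes:
  fixes p q n b :: nat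
  assumes "prime p" "prime q" "p \<noteq> q" "n = p * q * b" "n > 0"
  shows "real (totient n + totient (p * b)) / real n * (1 + 1 / p) \<le> prb n (cone n b)"
    and "real (totient n) / real n * (1 + 1 / p) * (1 + 1 / q) \<le> prb n (cone n b)"
proof -
  have b: "b > 0" using assms by (auto intro: gr0I)
  have pq: "p > 1" "q > 1" using assms prime_gt_1_nat by auto
  have ne: "q * b \<noteq> b" "p * b \<noteq> b" "p * b \<noteq> q * b" "p * q * b \<noteq> b" "p * q * b \<noteq> p * b"
    "p * q * b \<noteq> q * b" using pq b assms(3) by auto
  have "{n, q * b, p * b, b} \<subseteq> cone n b" unfolding cone_def assms(4) by auto
  then have "prb n {n, q * b, p * b, b} \<le> prb n (cone n b)"
    using assms(5) by (intro prb_mono) (auto simp: cone_def)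
  moreover have "prb n {n, q * b, p * b, b} =
      (real (totient n) + real (totient (q * b)) + real (totient (p * b)) + real (totient b)) / real n"
    unfolding prb_def assms(4) using ne by simp
  ultimately have prb: "(real (totient n) + real (totient (q * b)) + real (totient (p * b)) + real (totient b)) / real n
      \<le> prb n (cone n b)" by simp
  have "totient n \<le> p * totient (q * b)" "totient (q * b) \<le> q * totient b"
    "totient (p * b) \<le> p * totient b" "totient n \<le> q * totient (p * b)"
    using totient_prime_mult_le[OF assms(1), of "q * b"] totient_prime_mult_le[OF assms(2), of "p * b"]
      totient_prime_mult_le[OF assms(1), of b] totient_prime_mult_le[OF assms(2), of b]
    unfolding assms(4) by (auto simp: mult_ac)
  then have le: "real (totient n) / p \<le> real (totient (q * b))" "real (totient (q * b)) / q \<le> real (totient b)"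
    "real (totient (p * b)) / p \<le> real (totient b)" "real (totient n) / q \<le> real (totient (p * b))"
    using pq by (simp_all add: field_simps flip: of_nat_mult)
  have "real (totient n + totient (p * b)) / real n * (1 + 1 / p) =
      (real (totient n) + real (totient n) / p + real (totient (p * b)) + real (totient (p * b)) / p) / real n"
    by (simp add: field_simps)
  also have "\<dots> \<le> (real (totient n) + real (totient (q * b)) + real (totient (p * b)) + real (totient b)) / real n"
    using le by (intro divide_right_mono) auto
  also note prb
  finally show "real (totient n + totient (p * b)) / real n * (1 + 1 / p) \<le> prb n (cone n b)" .
  have "real (totient n) / real n * (1 + 1 / p) * (1 + 1 / q) =
      (real (totient n) + real (totient n) / p + real (totient n) / q + real (totient n) / p / q) / real n"
    by (simp add: add_divide_distrib ring_distribs mult_ac)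
  also have "real (totient n) / p / q \<le> real (totient (q * b)) / q"
    using le(1) by (intro divide_right_mono) auto
  then have "(real (totient n) + real (totient n) / p + real (totient n) / q + real (totient n) / p / q) / real n
      \<le> (real (totient n) + real (totient (q * b)) + real (totient (p * b)) + real (totient b)) / real n"
    using le by (intro divide_right_mono) auto
  also note prb
  finally show "real (totient n) / real n * (1 + 1 / p) * (1 + 1 / q) \<le> prb n (cone n b)" .
qed

section \<open>Incomparable pairs and lower bounds on their residual\<close>

definition incomparable :: "nat \<Rightarrow> nat set \<Rightarrow> nat set \<Rightarrow> bool" where
  "incomparable n U V \<longleftrightarrow> up_set n U \<and> up_set n V \<and> \<not> U \<subseteq> V \<and> \<not> V \<subseteq> U"

text \<open>The probability that the order of a random element lies in both or in neither of \<open>U\<close> and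
  \<open>V\<close>, that is, the relative size of the cut-set that the pair describes.\<close>

definition residual :: "nat \<Rightarrow> nat set \<Rightarrow> nat set \<Rightarrow> real" where
  "residual n U V = 1 - prb n U - prb n V + 2 * prb n (U \<inter> V)"

definition optimal :: "nat \<Rightarrow> nat set \<Rightarrow> nat set \<Rightarrow> bool" where
  "optimal n U V \<longleftrightarrow> incomparable n U V \<and>
     (\<forall>U' V'. incomparable n U' V' \<longrightarrow> residual n U V \<le> residual n U' V')"

lemma residual_commute: "residual n U V = residual n V U"
  by (simp add: residual_def Int_commute)

lemma optimal_commute: "optimal n U V \<longleftrightarrow> optimal n V U"
  unfolding optimal_def incomparable_def by (metis residual_commute)

lemma residual_symdiff:
  assumes "finite U" "finite V"
  shows "residual n U V = 1 - prb n ((U - V) \<union> (V - U))"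
  using assms by (subst prb_Un_disjoint) (auto simp: residual_def prb_Diff Int_commute)

lemma residual_ge:
  assumes "n > 0" "up_set n U" "up_set n V"
  shows "1 - prb n U - prb n V + 2 * prb n U * prb n V \<le> residual n U V"
  using harris_up_sets[OF assms] by (simp add: residual_def)

text \<open>Otherwise \<open>(u - 1/2) * (v - 1/2)\<close> is nonnegative, and expanding it lifts
  the Harris bound to one half.\<close>

lemma residual_less_half:
  assumes "n > 0" "up_set n U" "up_set n V" "residual n U V < 1 / 2"
  shows "prb n U < 1 / 2 \<or> prb n V < 1 / 2"
proof (rule ccontr)
  assume "\<not> ?thesis"
  then have "0 \<le> (prb n U - 1 / 2) * (prb n V - 1 / 2)" by (intro mult_nonneg_nonneg) auto
  then have "1 / 2 \<le> 1 - prb n U - prb n V + 2 * prb n U * prb n V" by (simp add: field_simps)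
  then show False using residual_ge[OF assms(1-3)] assms(4) by linarith
qed

text \<open>An up-set without \<open>b\<close> contains no divisor of \<open>b\<close>, and these
  have total probability \<open>b / n\<close>.\<close>

lemma prb_avoiding_le:
  assumes "n > 0" "up_set n U" "b dvd n" "b \<notin> U"
  shows "prb n U \<le> 1 - real b / real n"
proof -
  have "U \<inter> {d. d dvd b} = {}" using assms unfolding up_set_def by blast
  moreover have "finite {d. d dvd b}" using assms by (auto intro: finite_divisors_nat dvd_pos_nat)
  ultimately have "prb n U + real b / real n = prb n (U \<union> {d. d dvd b})"
    using assms by (simp add: prb_Un_disjoint prb_divisors finite_up_set)
  also have "\<dots> \<le> prb n {d. d dvd n}"
    using assms by (intro prb_mono) (auto simp: up_set_def intro: dvd_trans)
  also have "\<dots> = 1" using assms by (simp add: prb_divisors)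
  finally show ?thesis by simp
qed

text \<open>The right side decreases in \<open>u\<close> since \<open>v < 1/2\<close>, and at
  \<open>u = 1 - y\<close> it does not decrease in \<open>v\<close>. The identity \<open>eq\<close>
  splits the excess into two nonnegative losses, both of which vanish in the equality case.\<close>

lemma bilinear_bound:
  fixes u v y w :: real
  assumes "u \<le> 1 - y" "w \<le> v" "v < 1 / 2" "y \<le> 1 / 2"
  shows "y + (1 - 2 * y) * w \<le> 1 - u - v + 2 * u * v"
    and "y < 1 / 2 \<Longrightarrow> 1 - u - v + 2 * u * v \<le> y + (1 - 2 * y) * w \<Longrightarrow> u = 1 - y \<and> v = w"
proof -
  have eq: "1 - u - v + 2 * u * v - (y + (1 - 2 * y) * w) = (1 - y - u) * (1 - 2 * v) + (1 - 2 * y) * (v - w)"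
    by (simp add: algebra_simps)
  have nonneg: "0 \<le> (1 - y - u) * (1 - 2 * v)" "0 \<le> (1 - 2 * y) * (v - w)"
    using assms by (auto intro!: mult_nonneg_nonneg)
  show "y + (1 - 2 * y) * w \<le> 1 - u - v + 2 * u * v" using eq nonneg by linarith
  assume "y < 1 / 2" "1 - u - v + 2 * u * v \<le> y + (1 - 2 * y) * w"
  then have "(1 - y - u) * (1 - 2 * v) = 0" "(1 - 2 * y) * (v - w) = 0"
    using eq nonneg by linarith+
  then show "u = 1 - y \<and> v = w" using assms \<open>y < 1 / 2\<close> by auto
qed

text \<open>With \<open>q\<close> the full power of one prime in \<open>n\<close>, this pair
  describes the cut-set \<open>Z_set\<close> at that prime. The two up-sets meet in the cone of
  \<open>M\<close> without \<open>M\<close> itself.\<close>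

lemma coprime_pair:
  fixes M q :: nat
  assumes "coprime M q" "M > 1" "q > 1"
  defines "n \<equiv> M * q"
  shows "incomparable n {d. d dvd n \<and> \<not> d dvd M} (cone n M)"
    and "residual n {d. d dvd n \<and> \<not> d dvd M} (cone n M) = 1 / q + (1 - 2 / q) * (totient M / M)"
proof -
  let ?U = "{d. d dvd n \<and> \<not> d dvd M}"
  have n: "n > 0" using assms by simp
  have "\<not> M dvd q" "\<not> q dvd M"
    using assms by (metis coprime_common_divisor_nat dvd_refl less_irrefl)+
  then have "q \<in> ?U - cone n M" "M \<in> cone n M - ?U" by (auto simp: n_def cone_def)
  then show "incomparable n ?U (cone n M)"
    unfolding incomparable_def using up_set_non_divisors up_set_cone by blast
  have fin: "finite {d. d dvd n}" using n by simp
  have fin': "finite ?U" "finite (cone n M)"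
    using n by (auto intro: finite_up_set up_set_cone)
  have "?U = {d. d dvd n} - {d. d dvd M}" by auto
  then have U: "prb n ?U = 1 - 1 / q"
    using fin n assms by (simp add: prb_Diff Int_absorb1 prb_divisors Collect_mono dvd_mult2 Int_commute
        del: Collect_conj_eq) (simp add: n_def Int_absorb2 Collect_mono prb_divisors)
  have V: "prb n (cone n M) = totient M / M"
    unfolding n_def using assms by (intro prb_cone_coprime) auto
  have "?U \<inter> cone n M = cone n M - {M}"
    by (auto simp: cone_def n_def intro: dvd_antisym)
  moreover have "cone n M \<inter> {M} = {M}" by (auto simp: cone_def n_def)
  ultimately have I: "prb n (?U \<inter> cone n M) = totient M / M - totient M / n"
    using fin' V by (simp add: prb_Diff) (simp add: prb_def)
  show "residual n ?U (cone n M) = 1 / q + (1 - 2 / q) * (totient M / M)"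
    unfolding residual_def U V I using assms by (simp add: n_def field_simps)
qed

text \<open>Splits the classification of optimal pairs, with \<open>b\<close> taken from
  \<open>V - U\<close>; each alternative has its own bound on the residual.\<close>

lemma cofactor_cases:
  fixes b n :: nat
  assumes "b dvd n" "b \<noteq> n" "n > 0"
  obtains (prime_power) p s where "prime p" "s > 0" "n = p ^ s * b"
    | (two_primes) p q where "prime p" "prime q" "p < q" "p * q * b dvd n"
proof -
  obtain c where c: "n = b * c" using assms by auto
  then have "c > 0" "c \<noteq> 1" using assms by auto
  then obtain p where p: "prime p" "p dvd c" using prime_factor_nat by blast
  show thesis
  proof (cases "\<exists>q. prime q \<and> q dvd c \<and> q \<noteq> p")
    case True
    then obtain q where q: "prime q" "q dvd c" "q \<noteq> p" by auto
    then have "coprime p q" using p primes_coprime by blast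
    then have "p * q dvd c" using p q by (simp add: divides_mult)
    then have "p * q * b dvd n" unfolding c by (simp add: mult.commute)
    then show thesis using two_primes[of p q] two_primes[of q p] p q
      by (metis linorder_neqE_nat mult.commute)
  next
    case False
    obtain m where m: "c = p ^ multiplicity p c * m" "\<not> p dvd m"
      using multiplicity_decompose'[of c p] \<open>c > 0\<close> p
      by (metis gr_implies_not0 not_prime_unit)
    have "m = 1"
    proof (rule ccontr)
      assume "m \<noteq> 1"
      then obtain q where q: "prime q" "q dvd m" using prime_factor_nat by blast
      then have "q dvd c" using m(1) by (metis dvd_mult)
      then show False using False q m(2) by auto
    qed
    then have "c = p ^ multiplicity p c" using m(1) by simp
    moreover have "multiplicity p c > 0"
      using p \<open>c > 0\<close> by (simp add: prime_multiplicity_gt_zero_iff)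
    ultimately show thesis using prime_power[of p "multiplicity p c"] p c by (simp add: mult.commute)
  qed
qed

section \<open>Optimal pairs for a factored number\<close>

locale prime_product =
  fixes p m :: "nat \<Rightarrow> nat" and r n :: nat
  assumes prime: "i \<in> {1..r} \<Longrightarrow> prime (p i)"
    and mono: "strict_mono_on {1..r} p"
    and exponent: "i \<in> {1..r} \<Longrightarrow> m i > 0"
    and n_eq: "n = (\<Prod>i=1..r. p i ^ m i)"
begin

definition cofactor :: "nat \<Rightarrow> nat" where
  "cofactor a = (\<Prod>i\<in>{1..r} - {a}. p i ^ m i)"

definition ratio :: "nat \<Rightarrow> real" where
  "ratio a = totient (cofactor a) / cofactor a"

text \<open>The relative size of \<open>Z_set\<close> at \<open>a\<close> with
  \<open>s = m a\<close>, in the form given by \<open>coprime_pair\<close>.\<close>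

definition cut_value :: "nat \<Rightarrow> real" where
  "cut_value a = (1 / p a) ^ m a + (1 - 2 * (1 / p a) ^ m a) * ratio a"

abbreviation high :: "nat \<Rightarrow> nat set" where
  "high a \<equiv> {d. d dvd n \<and> \<not> d dvd cofactor a}"

lemma p_pos: "i \<in> {1..r} \<Longrightarrow> p i > 0"
  using prime prime_gt_0_nat by blast

lemma p_inj: "i \<in> {1..r} \<Longrightarrow> j \<in> {1..r} \<Longrightarrow> p i = p j \<longleftrightarrow> i = j"
  using mono by (metis strict_mono_on_eqD)

lemma p_less: "i \<in> {1..r} \<Longrightarrow> j \<in> {1..r} \<Longrightarrow> p i < p j \<longleftrightarrow> i < j"
  using mono strict_mono_on_less by blast

lemma n_pos: "n > 0"
  unfolding n_eq using p_pos by (auto intro: prod_pos)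

lemma coprime_powers:
  "i \<in> {1..r} \<Longrightarrow> j \<in> {1..r} \<Longrightarrow> i \<noteq> j \<Longrightarrow> coprime (p i ^ k) (p j ^ l)"
  using primes_coprime[of "p i" "p j"] prime p_inj by (intro coprime_power_left_iff[THEN iffD2] disjI1
    coprime_power_right_iff[THEN iffD2]) blast

lemma n_split: "a \<in> {1..r} \<Longrightarrow> n = cofactor a * p a ^ m a"
  unfolding cofactor_def by (subst n_eq, subst prod.remove[of "{1..r}" a]) auto

lemma cofactor_dvd: "a \<in> {1..r} \<Longrightarrow> cofactor a dvd n"
  by (rule dvdI[OF n_split])

lemma cofactor_pos: "a \<in> {1..r} \<Longrightarrow> cofactor a > 0"
  by (rule dvd_pos_nat[OF n_pos cofactor_dvd])

lemma coprime_cofactor: "a \<in> {1..r} \<Longrightarrow> coprime (cofactor a) (p a ^ k)"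
  unfolding cofactor_def by (intro prod_coprime_left coprime_powers) auto

lemma totient_prime_power_ratio:
  assumes "a \<in> {1..r}"
  shows "totient (p a ^ m a) / p a ^ m a = 1 - 1 / p a"
proof -
  have a: "prime (p a)" "m a > 0" using prime exponent assms by auto
  then have "p a \<ge> 1" using prime_gt_0_nat[of "p a"] by linarith
  then show ?thesis
    using a by (simp add: totient_prime_power of_nat_diff field_simps flip: power_Suc)
qed

text \<open>The exponents cancel, so the ratio depends on the primes alone and can be computed in
  the radical of \<open>n\<close>.\<close>

lemma ratio_eq:
  assumes "a \<in> {1..r}"
  shows "ratio a = (\<Prod>i\<in>{1..r} - {a}. 1 - 1 / p i)"
proof -
  have "totient (cofactor a) = (\<Prod>i\<in>{1..r} - {a}. totient (p i ^ m i))"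
    unfolding cofactor_def
  proof (rule totient_prod_coprime)
    show "pairwise coprime ((\<lambda>i. p i ^ m i) ` ({1..r} - {a}))"
      using coprime_powers unfolding pairwise_def by blast
    show "inj_on (\<lambda>i. p i ^ m i) ({1..r} - {a})"
    proof (rule inj_onI, rule ccontr)
      fix i j assume ij: "i \<in> {1..r} - {a}" "j \<in> {1..r} - {a}" "p i ^ m i = p j ^ m j" "i \<noteq> j"
      then have "coprime (p i ^ m i) (p i ^ m i)"
        using coprime_powers[of i j "m i" "m j"] by auto
      then have "p i ^ m i = 1" by simp
      then show False using ij(1) prime[of i] exponent[of i] prime_gt_1_nat[of "p i"] by auto
    qed
  qed
  then have "ratio a = (\<Prod>i\<in>{1..r} - {a}. totient (p i ^ m i) / (p i ^ m i))"
    unfolding ratio_def by (simp add: cofactor_def prod_dividef)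
  also have "\<dots> = (\<Prod>i\<in>{1..r} - {a}. 1 - 1 / p i)"
    by (intro prod.cong refl totient_prime_power_ratio) auto
  finally show ?thesis .
qed

text \<open>The right side is independent of \<open>a\<close>, which makes ratios at different
  indices comparable.\<close>

lemma ratio_mult:
  assumes "a \<in> {1..r}"
  shows "ratio a * (1 - 1 / p a) = (\<Prod>i=1..r. 1 - 1 / p i)"
  unfolding ratio_eq[OF assms] using assms by (subst prod.remove[of "{1..r}" a]) auto

lemma totient_ratio:
  assumes "a \<in> {1..r}"
  shows "totient n / n = ratio a * (1 - 1 / p a)"
proof -
  have "totient n = totient (cofactor a) * totient (p a ^ m a)"
    unfolding n_split[OF assms] by (rule totient_mult_coprime[OF coprime_cofactor[OF assms]])
  moreover have "real n = real (cofactor a) * (p a ^ m a)"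
    using n_split[OF assms] by (metis of_nat_mult of_nat_power)
  ultimately have "totient n / n = ratio a * (totient (p a ^ m a) / (p a ^ m a))"
    by (simp add: ratio_def)
  then show ?thesis by (simp only: totient_prime_power_ratio[OF assms])
qed

lemma prime_factor_index:
  assumes "prime q" "q dvd n"
  obtains i where "i \<in> {1..r}" "q = p i"
proof -
  obtain i where "i \<in> {1..r}" "q dvd p i ^ m i"
    using assms unfolding n_eq by (auto simp: prime_dvd_prod_iff)
  then show thesis using that prime assms(1) by (meson prime_dvd_power primes_dvd_imp_eq)
qed

lemma cofactor_gt_1:
  assumes "a \<in> {1..r}" "r \<ge> 2"
  shows "cofactor a > 1"
proof -
  define b where "b = (if a = 1 then 2 else 1 :: nat)"
  have b: "b \<in> {1..r} - {a}" using assms by (auto simp: b_def)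
  then have "p b dvd p b ^ m b" using exponent by (intro dvd_power) auto
  also have "\<dots> dvd cofactor a" unfolding cofactor_def using b by (intro dvd_prodI) auto
  finally have "p b \<le> cofactor a" using cofactor_pos[OF assms(1)] by (rule dvd_imp_le)
  then show ?thesis using prime_gt_1_nat[OF prime[of b]] b by auto
qed

lemma prb_cone_cofactor: "a \<in> {1..r} \<Longrightarrow> prb n (cone n (cofactor a)) = ratio a"
  unfolding ratio_def
  using prb_cone_coprime[OF coprime_cofactor, of a "m a"] cofactor_pos p_pos
  by (simp flip: n_split)

section \<open>Canonical pairs, and optimal pairs separated by a power of one prime\<close>

lemma canonical_pair:
  assumes "a \<in> {1..r}" "r \<ge> 2"
  shows "incomparable n (high a) (cone n (cofactor a))"
    and "residual n (high a) (cone n (cofactor a)) = cut_value a"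
proof -
  have "p a ^ m a > 1"
    using prime_gt_1_nat[OF prime[OF assms(1)]] exponent[OF assms(1)] by (intro one_less_power) auto
  note * = coprime_pair[OF coprime_cofactor[OF assms(1)] cofactor_gt_1[OF assms] this]
  show "incomparable n (high a) (cone n (cofactor a))"
    using *(1) unfolding n_split[OF assms(1), symmetric] .
  show "residual n (high a) (cone n (cofactor a)) = cut_value a"
    using *(2) unfolding n_split[OF assms(1), symmetric]
    by (simp add: cut_value_def ratio_def power_divide)
qed

text \<open>Adding the cone of the cofactor to \<open>V\<close> does not change
  \<open>U \<inter> V\<close>: each new divisor is the cofactor times a power of \<open>p a\<close>,
  hence a multiple of \<open>b\<close>, already in \<open>V\<close>, or a divisor of
  \<open>b\<close>, outside \<open>U\<close>. A proper enlargement would therefore lower the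
  residual.\<close>

lemma optimal_contains_cofactor:
  assumes opt: "optimal n U V" and a: "a \<in> {1..r}" and b: "b \<in> V" "b \<notin> U"
    and s: "n = p a ^ s * b"
  shows "cofactor a \<in> V" "s \<le> m a"
proof -
  have up: "up_set n U" "up_set n V" and ne: "\<not> U \<subseteq> V" "\<not> V \<subseteq> U"
    using opt by (auto simp: optimal_def incomparable_def)
  have "p a ^ s dvd cofactor a * p a ^ m a" using s n_split[OF a] by (metis dvd_triv_left)
  then have "p a ^ s dvd p a ^ m a"
    using coprime_cofactor[OF a] by (simp add: coprime_commute coprime_dvd_mult_right_iff)
  then show sm: "s \<le> m a" using prime_gt_1_nat[OF prime[OF a]] by (simp add: power_dvd_imp_le)
  \<comment> \<open>Cancelling \<open>p a ^ s\<close> shows that \<open>b\<close> is the cofactor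
    times the remaining power of \<open>p a\<close>.\<close>
  have "p a ^ s * p a ^ (m a - s) = p a ^ m a" using sm by (simp flip: power_add)
  then have "p a ^ s * b = p a ^ s * (cofactor a * p a ^ (m a - s))"
    unfolding s[symmetric] mult.left_commute[of _ "cofactor a"] using n_split[OF a] by simp
  then have b_eq: "b = cofactor a * p a ^ (m a - s)" using p_pos[OF a] by simp
  define V' where "V' = V \<union> cone n (cofactor a)"
  have fin: "finite V'" "finite V" using up n_pos by (auto simp: V'_def intro: finite_up_set[OF up_set_cone] finite_up_set)
  have disj: "d \<notin> U" if "d \<in> V' - V" for d
  proof
    assume "d \<in> U"
    have d: "d dvd n" "cofactor a dvd d" using that by (auto simp: V'_def cone_def)
    then obtain e where e: "d = cofactor a * e" by auto
    have "cofactor a * e dvd cofactor a * p a ^ m a" using d(1) unfolding e n_split[OF a, symmetric] .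
    then have "e dvd p a ^ m a" using cofactor_pos[OF a] by simp
    then obtain k where k: "e = p a ^ k" using prime[OF a] by (auto simp: divides_primepow_nat)
    show False
    proof (cases "m a - s \<le> k")
      case True
      then have "b dvd d" unfolding b_eq e k by (intro mult_dvd_mono le_imp_power_dvd) auto
      then have "d \<in> V" using b(1) up(2) d(1) unfolding up_set_def by blast
      then show False using that by simp
    next
      case False
      then have "d dvd b" unfolding b_eq e k by (intro mult_dvd_mono le_imp_power_dvd) auto
      moreover have "b dvd n" using s by simp
      ultimately show False using \<open>d \<in> U\<close> b(2) up(1) unfolding up_set_def by blast
    qed
  qed
  then have "U \<inter> V' = U \<inter> V" "\<not> U \<subseteq> V'" "\<not> V' \<subseteq> U"
    using ne by (auto simp: V'_def)
  moreover have "up_set n V'" unfolding V'_def by (intro up_set_Un up up_set_cone)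
  ultimately have "residual n U V \<le> residual n U V'" "U \<inter> V' = U \<inter> V"
    using opt up unfolding optimal_def incomparable_def by blast+
  then have "prb n V' \<le> prb n V" by (simp add: residual_def)
  then have "V = V'"
    using fin n_pos up(2)
    by (intro prb_eq_imp_eq[of V' V n]) (auto simp: V'_def up_set_def cone_def intro: dvd_pos_nat)
  moreover have "cofactor a \<in> cone n (cofactor a)" using cofactor_dvd[OF a] by (simp add: cone_def)
  ultimately show "cofactor a \<in> V" by (auto simp: V'_def)
qed

text \<open>\<open>bilinear_bound\<close> applies with \<open>y = b / n\<close> and
  \<open>w = ratio a\<close>, since \<open>U\<close> misses \<open>b\<close> and \<open>V\<close>
  contains the cone of the cofactor. In the last claim the bound is attained, which fixes both
  probabilities and then both sets.\<close>

lemma optimal_single_prime: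
  assumes opt: "optimal n U V" and a: "a \<in> {1..r}" and b: "b \<in> V" "b \<notin> U"
    and s: "n = p a ^ s * b" "s > 0" and v: "prb n V < 1 / 2"
  shows "ratio a \<le> prb n V"
    and "(1 / p a) ^ s + (1 - 2 * (1 / p a) ^ s) * ratio a \<le> residual n U V"
    and "s = m a \<Longrightarrow> p a > 2 \<Longrightarrow> residual n U V \<le> cut_value a \<Longrightarrow> U = high a \<and> V = cone n (cofactor a)"
proof -
  have up: "up_set n U" "up_set n V" using opt by (auto simp: optimal_def incomparable_def)
  note c = optimal_contains_cofactor[OF opt a b s(1)]
  have fin: "finite U" "finite V" using up n_pos by (auto intro: finite_up_set)
  have sub: "cone n (cofactor a) \<subseteq> V" by (rule cone_subset[OF up(2) c(1)])
  then show w: "ratio a \<le> prb n V"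
    using prb_mono[OF fin(2) sub, of n] by (simp add: prb_cone_cofactor[OF a])
  have b0: "b > 0" using s n_pos by (auto intro: gr0I)
  have "real n = real (p a) ^ s * real b" using s by (metis of_nat_mult of_nat_power)
  then have "real b / real n = (1 / p a) ^ s" using b0 p_pos[OF a] by (simp add: power_divide)
  then have u: "prb n U \<le> 1 - (1 / p a) ^ s"
    using prb_avoiding_le[OF n_pos up(1) _ b(2)] s by simp
  have p2: "p a \<ge> 2" using prime_ge_2_nat[OF prime[OF a]] .
  have le: "(1 / p a) ^ s \<le> (1 / p a) ^ 1" using s(2) p2 by (intro power_decreasing) auto
  also have "\<dots> \<le> 1 / 2" using p2 by (simp add: field_simps)
  finally have y: "(1 / p a) ^ s \<le> 1 / 2" .
  note bb = bilinear_bound[OF u w v y]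
  show "(1 / p a) ^ s + (1 - 2 * (1 / p a) ^ s) * ratio a \<le> residual n U V"
    using bb(1) residual_ge[OF n_pos up] by linarith
  assume sm: "s = m a" and p3: "p a > 2" and le_cut: "residual n U V \<le> cut_value a"
  \<comment> \<open>The equality case of \<open>bilinear_bound\<close> requires \<open>y\<close>
    strictly below one half.\<close>
  have "1 / real (p a) < 1 / 2" using p3 by (simp add: field_simps)
  then have "(1 / p a) ^ s < 1 / 2" using le by simp
  moreover have "1 - prb n U - prb n V + 2 * prb n U * prb n V \<le> (1 / p a) ^ s + (1 - 2 * (1 / p a) ^ s) * ratio a"
    using residual_ge[OF n_pos up] le_cut unfolding cut_value_def sm by linarith
  ultimately have eq: "prb n U = 1 - (1 / p a) ^ s" "prb n V = ratio a" using bb(2) by auto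
  have "cone n (cofactor a) = V"
    using sub fin up n_pos eq(2)
    by (intro prb_eq_imp_eq[of V _ n]) (auto simp: up_set_def prb_cone_cofactor[OF a] intro: dvd_pos_nat)
  \<comment> \<open>At full exponent \<open>b\<close> is the cofactor itself, so \<open>U\<close>
    contains none of its divisors.\<close>
  have "p a ^ m a * b = p a ^ m a * cofactor a" using s sm n_split[OF a] by (metis mult.commute)
  then have "b = cofactor a" using p_pos[OF a] by simp
  then have subU: "U \<subseteq> high a" using b(2) up(1) cofactor_dvd[OF a] unfolding up_set_def by auto
  have "prb n (high a) \<le> 1 - real (cofactor a) / real n"
    using cofactor_dvd[OF a] by (intro prb_avoiding_le n_pos up_set_non_divisors) auto
  also have "real (cofactor a) / real n = (1 / p a) ^ s"
    using \<open>b = cofactor a\<close> \<open>real b / real n = (1 / p a) ^ s\<close> by simp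
  finally have "U = high a"
    using subU n_pos eq(1) by (intro prb_eq_imp_eq[of "high a" U n]) (auto intro: dvd_pos_nat)
  with \<open>cone n (cofactor a) = V\<close> show "U = high a \<and> V = cone n (cofactor a)" by simp
qed

text \<open>The ratio at an index lacks the factor of that prime, and the factor of a larger prime
  is closer to one.\<close>

lemma ratio_antimono:
  assumes "a \<in> {1..r}" "b \<in> {1..r}" "a \<le> b"
  shows "ratio b \<le> ratio a"
proof -
  have p1: "p a > 1" "p b > 1" using prime assms prime_gt_1_nat by blast+
  have "p a \<le> p b" using p_less[OF assms(1,2)] p_inj[OF assms(1,2)] assms(3) by (cases "a = b") auto
  then have le: "1 - 1 / real (p a) \<le> 1 - 1 / real (p b)"
    using p1 by (intro one_minus_inverse_mono) auto
  have pos: "0 < 1 - 1 / real (p a)" using p1 by (simp add: field_simps)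
  have "ratio b * (1 - 1 / p a) \<le> ratio b * (1 - 1 / p b)"
    using le by (intro mult_left_mono) (auto simp: ratio_def)
  also have "\<dots> = ratio a * (1 - 1 / p a)" using ratio_mult assms by simp
  finally show ?thesis using pos by simp
qed

text \<open>With exponents one the last prime gives the smaller cut-set. For \<open>T\<close> the
  product over the remaining primes the sides differ by \<open>(x - y) * (1 - T)\<close>, and
  \<open>T < 1\<close> because \<open>ratio r < 1/2 \<le> 1 - x\<close>.\<close>

lemma single_layer_bound:
  assumes "a \<in> {1..r}" "a < r" "ratio r < 1 / 2"
  shows "1 / p r + (1 - 2 * (1 / p r)) * ratio r < 1 / p a + (1 - 2 * (1 / p a)) * ratio a"
proof -
  have r: "r \<in> {1..r}" using assms by auto
  have p2: "p a \<ge> 2" "p r > 1" using prime[OF assms(1)] prime[OF r] prime_ge_2_nat prime_gt_1_nat by blast+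
  define x y where "x = 1 / real (p a)" and "y = 1 / real (p r)"
  have "p a < p r" using p_less[OF assms(1) r] assms(2) by simp
  then have xy: "y < x" "x \<le> 1 / 2" using p2 by (auto simp: x_def y_def field_simps)
  define T where "T = ratio r / (1 - x)"
  have T: "ratio r = T * (1 - x)" using xy by (simp add: T_def)
  have "ratio a * (1 - x) = T * (1 - x) * (1 - y)"
    using ratio_mult[OF assms(1)] ratio_mult[OF r] T by (simp add: x_def y_def)
  then have Ta: "ratio a = T * (1 - y)" using xy by (simp add: mult.commute mult.left_commute)
  have "T < 1"
    unfolding T_def using xy assms(3) by (subst pos_divide_less_eq) auto
  then have "0 < (x - y) * (1 - T)" using xy by (intro mult_pos_pos) auto
  then show ?thesis unfolding Ta T x_def[symmetric] y_def[symmetric] by (simp add: algebra_simps)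
qed

section \<open>Four or five primes with totient ratio below one half\<close>

context
  assumes r45: "r \<in> {4, 5}" and half: "ratio r < 1 / 2"
begin

lemma r_mem: "r \<in> {1..r}" "r \<ge> 2"
  using r45 by auto

lemma ratio_last:
  "r = 4 \<Longrightarrow> ratio r = (1 - 1 / p 1) * (1 - 1 / p 2) * (1 - 1 / p 3)"
  "r = 5 \<Longrightarrow> ratio r = (1 - 1 / p 1) * (1 - 1 / p 2) * (1 - 1 / p 3) * (1 - 1 / p 4)"
proof -
  have "{1..4} - {4} = {1, 2, 3 :: nat}" "{1..5} - {5} = {1, 2, 3, 4 :: nat}" by auto
  then show "r = 4 \<Longrightarrow> ratio r = (1 - 1 / p 1) * (1 - 1 / p 2) * (1 - 1 / p 3)"
    "r = 5 \<Longrightarrow> ratio r = (1 - 1 / p 1) * (1 - 1 / p 2) * (1 - 1 / p 3) * (1 - 1 / p 4)"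
    using ratio_eq[OF r_mem(1)] by simp_all
qed

lemma primes_sorted: "p 1 < p 2" "p 2 < p 3" "p 3 < p 4" "r = 5 \<Longrightarrow> p 4 < p 5"
  and primes_prime: "prime (p 1)" "prime (p 2)" "prime (p 3)" "prime (p 4)" "r = 5 \<Longrightarrow> prime (p 5)"
  using r45 by (auto intro!: prime simp: p_less)

lemma first_prime: "p 1 \<in> {2, 3}"
proof (rule smallest_prime_bound)
  show "prime (p 1)" "p 1 < p 2" "p 2 < p 3" using primes_prime primes_sorted by auto
  show "(1 - 1 / p 1) * (1 - 1 / p 2) * (1 - 1 / p 3) < 1 / 2 \<or>
      p 3 < p 4 \<and> (1 - 1 / p 1) * (1 - 1 / p 2) * (1 - 1 / p 3) * (1 - 1 / p 4) < 1 / 2"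
    using half r45 ratio_last primes_sorted(3) by auto
qed

context
  assumes last: "m r = 1" and p5: "r = 5 \<Longrightarrow> p 1 = 3"
begin

lemma cut_value_last: "cut_value r = ratio r + 1 / p r * (1 - 2 * ratio r)"
  by (simp add: cut_value_def last algebra_simps)

text \<open>Excludes the indices up to \<open>r - 2\<close> in the single-prime case. Ratios
  decrease with the index, so only \<open>e = r - 2\<close> matters, where
  \<open>second_last_bound\<close> reduces the claim to the gap bounds.\<close>

lemma ratio_ge_cut_value:
  assumes "a \<in> {1..r}" "a + 2 \<le> r"
  shows "cut_value r \<le> ratio a"
proof -
  define e where "e = r - 2"
  have e: "e \<in> {1..r}" "a \<le> e" using assms r45 by (auto simp: e_def)
  have pos: "1 - 1 / real (p e) > 0" "p e > 0" "p r > 0"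
    using prime_gt_1_nat[OF prime[OF e(1)]] prime_gt_1_nat[OF prime[OF r_mem(1)]] by (auto simp: field_simps)
  define T where "T = ratio r / (1 - 1 / p e)"
  have T: "ratio r = T * (1 - 1 / p e)" using pos by (simp add: T_def)
  have "ratio e * (1 - 1 / p e) = T * (1 - 1 / p r) * (1 - 1 / p e)"
    using ratio_mult[OF e(1)] ratio_mult[OF r_mem(1)] T by (simp add: mult_ac)
  then have Te: "ratio e = T * (1 - 1 / p r)" using pos(1) by auto
  have "real (p e) \<le> T * (real (p r) + real (p e) - 2)"
  proof (cases "r = 4")
    case True
    then have "T = (1 - 1 / p 1) * (1 - 1 / p 3)" "e = 2"
      using pos(1) ratio_last(1) by (auto simp: T_def e_def)
    then show ?thesis
      using gap_bound_4[of "p 2" "p 3" "p 4" "p 1"] first_prime primes_prime primes_sorted True by simp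
  next
    case False
    then have r5: "r = 5" using r45 by simp
    then have T5: "T = (1 - 1 / 3) * (1 - 1 / p 2) * (1 - 1 / p 4)" and e3: "e = 3"
      using pos(1) ratio_last(2) p5 by (auto simp: T_def e_def)
    have "3 < p 2" using primes_sorted(1) p5[OF r5] by simp
    then show ?thesis
      unfolding T5 e3 r5 using r5 by (intro gap_bound_5 primes_prime primes_sorted)
  qed
  then have "cut_value r \<le> ratio e"
    unfolding cut_value_last Te unfolding T using second_last_bound[of "p e" "p r" T] pos by simp
  also have "\<dots> \<le> ratio a" by (rule ratio_antimono[OF assms(1) e])
  finally show ?thesis .
qed

text \<open>\<open>ratio r * (1 + 1 / p j)\<close> will bound the probability of a cone over
  \<open>n / (p j * p k)\<close> from below. If \<open>ratio r\<close> is at least 1/3,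
  \<open>last_factor_bound\<close> applies; otherwise the primes start with 2, 3 and
  \<open>bound_2_3\<close> leaves only twin primes open.\<close>

lemma two_layer_bound:
  assumes "j \<in> {1..r}" "j < r"
  shows "cut_value r \<le> ratio r * (1 + 1 / p j) \<or> r = 4 \<and> j = 3 \<and> p 1 = 2 \<and> p 2 = 3 \<and> p 4 = p 3 + 2"
proof (cases "1 / 3 \<le> ratio r")
  case True
  have "p j < p r" "p j > 0" using p_less[OF assms(1) r_mem(1)] assms(2) p_pos assms(1) by auto
  then show ?thesis unfolding cut_value_last
    using True by (intro disjI1 last_factor_bound) (auto simp: frac_le)
next
  case False
  have "r \<noteq> 5"
  proof
    assume "r = 5"
    then show False using False third_bound(2)[of "p 1" "p 2" "p 3" "p 4"] p5 primes_sorted ratio_last(2) by simp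
  qed
  then have r4: "r = 4" using r45 by simp
  have "\<not> 1 / 3 \<le> (1 - 1 / p 1) * (1 - 1 / p 2) * (1 - 1 / p 3)"
    using False ratio_last(1) r4 by simp
  moreover have "2 \<le> p 1" using first_prime by auto
  ultimately have "p 1 = 2 \<and> p 2 \<le> 4"
    using third_bound(1)[of "p 1" "p 2" "p 3"] primes_sorted by blast
  moreover have "p 2 \<noteq> 4" using primes_prime(2) not_prime_4 by auto
  ultimately have p12: "p 1 = 2" "p 2 = 3" using primes_sorted by auto
  then have c: "ratio r = 1 / 3 * (1 - 1 / p 3)" using ratio_last(1) r4 by simp
  have "3 < p 3" using primes_sorted p12 by simp
  note b = bound_2_3[OF primes_prime(3,4) this primes_sorted(3)]
  consider "j = 1" | "j = 2" | "j = 3" using assms r4 by fastforce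
  then show ?thesis
  proof cases
    case 1
    \<comment> \<open>For \<open>p j = 2\<close> the stronger bound with 3 in place of 2 is
      available.\<close>
    have "cut_value r \<le> ratio r * (1 + 1 / 3)" unfolding cut_value_last c using b(2) r4 by simp
    also have "\<dots> \<le> ratio r * (1 + 1 / 2)" by (intro mult_left_mono) (auto simp: ratio_def)
    finally show ?thesis using 1 p12 by simp
  next
    case 2
    then show ?thesis unfolding cut_value_last c using b(2) r4 p12 by simp
  next
    case 3
    then show ?thesis unfolding cut_value_last c using b(3) r4 p12 by auto
  qed
qed

text \<open>\<open>V\<close> contains the multiple \<open>b' = n / (p j * p k)\<close> of
  \<open>b\<close>, so its probability is at least that of the cone of \<open>b'\<close>. The
  residual then exceeds the cut value of the last prime by \<open>two_layer_bound\<close>, apart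
  from the twin-prime case treated at the end.\<close>

lemma optimal_two_primes:
  assumes opt: "optimal n U V" and v: "prb n V < 1 / 2" and b: "b \<in> V" "b \<notin> U"
    and jk: "j \<in> {1..r}" "k \<in> {1..r}" "j < k" "p j * p k * b dvd n"
  shows False
proof -
  have up: "up_set n U" "up_set n V" using opt by (auto simp: optimal_def incomparable_def)
  have finV: "finite V" using up n_pos by (auto intro: finite_up_set)
  have min: "residual n U V \<le> cut_value a" if "a \<in> {1..r}" for a
    using opt canonical_pair[OF that r_mem(2)] unfolding optimal_def by metis
  have bn: "b dvd n" "b > 0" using jk(4) n_pos by (auto intro: dvd_mult_right dvd_pos_nat)
  have pj: "p j > 1" using prime_gt_1_nat[OF prime[OF jk(1)]] .
  define Y where "Y = real b / real n"
  have Y0: "Y > 0" using bn n_pos by (simp add: Y_def)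
  have "p j * b \<le> n" using jk(4) n_pos by (intro dvd_imp_le) (auto intro: dvd_trans)
  moreover have "2 * b \<le> p j * b" using pj by (intro mult_right_mono) auto
  ultimately have "2 * b \<le> n" by linarith
  then have Y: "Y \<le> 1 / 2" using n_pos by (simp add: Y_def field_simps)
  \<comment> \<open>The bilinear bound equals \<open>w + Y * (1 - 2 * w)\<close>, so every lower
    bound on the probability of \<open>V\<close> is a strict one on the residual.\<close>
  have res: "w < residual n U V" if "w \<le> prb n V" for w
  proof -
    have "prb n U \<le> 1 - Y" unfolding Y_def using prb_avoiding_le[OF n_pos up(1) bn(1) b(2)] .
    from bilinear_bound(1)[OF this that v Y] residual_ge[OF n_pos up]
    have "Y + (1 - 2 * Y) * w \<le> residual n U V" by linarith
    moreover have "0 < Y * (1 - 2 * w)" using Y0 that v by (intro mult_pos_pos) auto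
    ultimately show ?thesis by (simp add: algebra_simps)
  qed
  obtain b' where b': "n = p j * p k * b'" "b dvd b'"
  proof -
    obtain e where "n = p j * p k * b * e" using jk(4) by auto
    then show thesis using that[of "b * e"] by simp
  qed
  have "b' \<in> V" using up(2) b(1) b' unfolding up_set_def by auto
  then have cone: "prb n (cone n b') \<le> prb n V" by (intro prb_mono finV cone_subset up)
  have ne: "p j \<noteq> p k" using p_inj jk by simp
  note two = prb_cone_two_primes[OF prime[OF jk(1)] prime[OF jk(2)] ne b'(1) n_pos]
  have "ratio r * (1 + 1 / p j) \<le> prb n (cone n b')"
  proof (cases "k = r")
    case True
    \<comment> \<open>For the last prime, \<open>p j * b'\<close> is \<open>cofactor r\<close>, and
      the weights of \<open>n\<close> and \<open>cofactor r\<close> add up to \<open>ratio r\<close>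
      exactly.\<close>
    have "p j * b' * p r = cofactor r * p r"
    proof -
      have "p j * b' * p r = n" using b'(1) True by (simp add: mult_ac)
      also have "n = cofactor r * p r" using n_split[OF r_mem(1)] last by simp
      finally show ?thesis .
    qed
    then have pb: "p j * b' = cofactor r" using p_pos[OF r_mem(1)] by simp
    have "real (cofactor r) / real n = 1 / p r"
    proof -
      have "real n = real (cofactor r) * real (p r)"
        using n_split[OF r_mem(1)] last by (metis of_nat_mult power_one_right)
      then show ?thesis using cofactor_pos[OF r_mem(1)] by simp
    qed
    moreover have "real (totient (cofactor r)) = ratio r * real (cofactor r)"
      using cofactor_pos[OF r_mem(1)] by (simp add: ratio_def)
    ultimately have "real (totient (cofactor r)) / real n = ratio r / p r"
      by (metis times_divide_eq_right mult.right_neutral)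
    then have "real (totient n + totient (p j * b')) / real n = ratio r"
      using totient_ratio[OF r_mem(1)] unfolding pb by (simp add: add_divide_distrib algebra_simps)
    then show ?thesis using two(1) by simp
  next
    case False
    then have "p k < p r" using p_less[OF jk(2) r_mem(1)] jk(2) by simp
    have pos: "p k > 0" "p r > 0" using p_pos jk r_mem by auto
    \<comment> \<open>The gain \<open>1 + 1 / p k\<close> makes up for the factor
      \<open>1 - 1 / p r\<close> by which \<open>totient n / n\<close> falls short of
      \<open>ratio r\<close>.\<close>
    have "real (p k) + 1 \<le> real (p r)" using \<open>p k < p r\<close> by simp
    then have "1 \<le> (1 - 1 / p r) * (1 + 1 / p k)"
      using pos by (simp add: field_simps)
    then have "ratio r * (1 + 1 / p j) * 1 \<le> ratio r * (1 + 1 / p j) * ((1 - 1 / p r) * (1 + 1 / p k))"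
      by (intro mult_left_mono) (auto simp: ratio_def)
    also have "\<dots> = real (totient n) / real n * (1 + 1 / p j) * (1 + 1 / p k)"
      using totient_ratio[OF r_mem(1)] by (simp add: mult_ac)
    also note two(2)
    finally show ?thesis by simp
  qed
  then have gt: "ratio r * (1 + 1 / p j) < residual n U V" using res cone by auto
  have "j < r" using jk by auto
  then have ex: "r = 4" "j = 3" "p 1 = 2" "p 2 = 3" "p 4 = p 3 + 2"
    using two_layer_bound[OF jk(1)] min[OF r_mem(1)] gt by auto
  then have k: "k = 4" using jk by auto
  have c: "ratio r = 1 / 3 * (1 - 1 / p 3)" using ratio_last(1) ex by simp
  have "3 < p 3" using primes_sorted ex by simp
  note bnd = bound_2_3[OF primes_prime(3,4) this primes_sorted(3)]
  show False
  proof (cases "p 3 dvd b")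
    case True
    \<comment> \<open>Now \<open>p 3\<close> divides both \<open>b\<close> and \<open>n / b\<close>,
      so its exponent is at least two, and the canonical pair at index 3 has a smaller
      residual.\<close>
    have "{1..4} - {3} = {1, 2, 4 :: nat}" by auto
    then have c3: "ratio 3 = 1 / 3 * (1 - 1 / p 4)" using ratio_eq[of 3] ex by simp
    have "p 3 * p 3 dvd n" using jk(4) True ex k
      by (meson dvd_trans dvd_triv_left mult_dvd_mono dvd_refl dvd_mult)
    moreover have "n = p 3 ^ m 3 * cofactor 3" using n_split[of 3] ex by (simp add: mult.commute)
    ultimately have "p 3 ^ 2 dvd p 3 ^ m 3 * cofactor 3" by (simp add: power2_eq_square)
    then have "p 3 ^ 2 dvd p 3 ^ m 3"
      using coprime_cofactor[of 3 2] ex by (simp add: coprime_commute coprime_dvd_mult_left_iff)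
    then have "2 \<le> m 3" using primes_prime(3) prime_gt_1_nat by (blast intro: power_dvd_imp_le)
    then have "cut_value 3 \<le> ratio r * (1 + 1 / p 3)"
      using bnd(4)[OF ex(5), of "m 3"] unfolding cut_value_def c3 c by simp
    then show False using gt min[of 3] ex by simp
  next
    case False
    \<comment> \<open>Here \<open>b\<close> divides the part \<open>M\<close> of \<open>n\<close>
      built from 2 and 3, so \<open>V\<close> contains the cone of \<open>M\<close>, whose
      probability 1/3 already reaches the cut value of the last prime.\<close>
    define M where "M = p 1 ^ m 1 * p 2 ^ m 2"
    have "{1..4} = {1, 2, 3, 4 :: nat}" by auto
    then have n4: "n = M * (p 3 ^ m 3 * p 4)" using n_eq ex last by (simp add: M_def mult_ac)
    have cop: "coprime M (p 3 ^ m 3 * p 4)"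
    proof -
      have "coprime (p i ^ m i) (p 3 ^ m 3 * p 4)" if "i \<in> {1, 2}" for i
        using coprime_powers[of i 3 "m i" "m 3"] coprime_powers[of i 4 "m i" 1] that ex(1) by auto
      then show ?thesis unfolding M_def coprime_mult_left_iff by blast
    qed
    have pos: "M > 0" "p 3 ^ m 3 * p 4 > 0" using n4 n_pos by (auto intro: gr0I)
    have "coprime (p 3) b" using primes_prime(3) False by (rule prime_imp_coprime)
    then have "coprime b (p 3 ^ m 3)" by (simp add: coprime_commute)
    moreover have "b * (p 3 * p 4) dvd M * p 3 ^ m 3 * p 4"
      using jk(4) n4 ex k by (simp add: mult_ac)
    then have "b * p 3 * p 4 dvd M * p 3 ^ m 3 * p 4" by (simp add: mult_ac)
    then have "b * p 3 dvd M * p 3 ^ m 3" using prime_gt_0_nat[OF primes_prime(4)] by simp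
    then have "b dvd M * p 3 ^ m 3" by (rule dvd_mult_left)
    ultimately have "b dvd M" by (simp add: coprime_dvd_mult_left_iff)
    then have "M \<in> V" using up(2) b(1) n4 unfolding up_set_def by auto
    then have "prb n (cone n M) \<le> prb n V" by (intro prb_mono finV cone_subset up)
    moreover have "prb n (cone n M) = totient M / M"
      unfolding n4 by (rule prb_cone_coprime[OF cop pos])
    moreover have "totient M / M = (1 - 1 / p 1) * (1 - 1 / p 2)"
    proof -
      have "coprime (p 1 ^ m 1) (p 2 ^ m 2)" using coprime_powers[of 1 2] ex by simp
      moreover have "totient (p i ^ m i) / p i ^ m i = 1 - 1 / p i" if "i \<in> {1..r}" for i
        using that by (rule totient_prime_power_ratio)
      from this[of 1] this[of 2] ex
      have "totient (p 1 ^ m 1) / p 1 ^ m 1 = 1 - 1 / p 1" "totient (p 2 ^ m 2) / p 2 ^ m 2 = 1 - 1 / p 2"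
        by simp_all
      ultimately show ?thesis unfolding M_def
        by (simp only: totient_mult_coprime of_nat_mult of_nat_power times_divide_times_eq[symmetric])
    qed
    ultimately have "1 / 3 < residual n U V" using res[of "1 / 3"] ex by simp
    moreover have "cut_value r \<le> 1 / 3" unfolding cut_value_last c using bnd(1) ex by simp
    ultimately show False using min[OF r_mem(1)] by simp
  qed
qed

text \<open>For \<open>b\<close> in \<open>V - U\<close> only a prime power \<open>n / b\<close>
  survives. The residual exceeds \<open>ratio a\<close>, which leaves the last two indices, and the
  equality case of \<open>optimal_single_prime\<close> then identifies the pair.\<close>

lemma optimal_classification:
  assumes opt: "optimal n U V" and v: "prb n V < 1 / 2"
  shows "U = high r \<and> V = cone n (cofactor r) \<or>
    m (r - 1) > 1 \<and> U = high (r - 1) \<and> V = cone n (cofactor (r - 1))"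
proof -
  have up: "up_set n U" "up_set n V" and ne: "\<not> V \<subseteq> U" "U \<noteq> {}"
    using opt by (auto simp: optimal_def incomparable_def)
  have min: "residual n U V \<le> cut_value a" if "a \<in> {1..r}" for a
    using opt canonical_pair[OF that r_mem(2)] unfolding optimal_def by metis
  obtain b where b: "b \<in> V" "b \<notin> U" using ne by auto
  have bn: "b dvd n" using b up by (auto simp: up_set_def)
  \<comment> \<open>Every nonempty up-set contains \<open>n\<close>.\<close>
  have "n \<in> U" using ne(2) up(1) unfolding up_set_def by fastforce
  then have "b \<noteq> n" using b by auto
  from bn this n_pos show ?thesis
  proof (cases rule: cofactor_cases)
    case (two_primes q q')
    then have "q dvd n" "q' dvd n" by (auto intro: dvd_mult_left dvd_mult_right dest: dvd_trans)
    then obtain j k where "j \<in> {1..r}" "k \<in> {1..r}" "q = p j" "q' = p k"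
      using prime_factor_index two_primes by metis
    then show ?thesis using optimal_two_primes[OF opt v b] two_primes p_less by metis
  next
    case (prime_power q s)
    then have "q dvd n" by auto
    then obtain a where a: "a \<in> {1..r}" "q = p a" using prime_factor_index prime_power(1) by metis
    note single = optimal_single_prime[OF opt a(1) b prime_power(3)[unfolded a(2)] prime_power(2) v]
    have sm: "s \<le> m a" using optimal_contains_cofactor(2)[OF opt a(1) b] prime_power a(2) by simp
    have lt: "ratio a < 1 / 2" using single(1) v by simp
    have p1: "p a > 1" using prime_gt_1_nat[OF prime[OF a(1)]] .
    have res: "ratio a + (1 / p a) ^ s * (1 - 2 * ratio a) \<le> residual n U V"
      using single(2) by (simp add: algebra_simps)
    have "0 < (1 / p a) ^ s * (1 - 2 * ratio a)" using p1 lt by (intro mult_pos_pos) auto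
    then have "ratio a < cut_value r" using res min[OF r_mem(1)] by simp
    then have "\<not> a + 2 \<le> r" using ratio_ge_cut_value[OF a(1)] by auto
    then have ar: "a = r \<or> a = r - 1" using a(1) by auto
    \<comment> \<open>A smaller \<open>s\<close> would lift the lower bound above
      \<open>cut_value a\<close>, against optimality.\<close>
    have s_eq: "s = m a"
    proof (rule ccontr)
      assume "s \<noteq> m a"
      then have "(1 / p a) ^ m a < (1 / p a) ^ s"
        using sm p1 by (intro power_strict_decreasing) auto
      then have "(1 / p a) ^ m a * (1 - 2 * ratio a) < (1 / p a) ^ s * (1 - 2 * ratio a)"
        using lt by (intro mult_strict_right_mono) auto
      then have "cut_value a < (1 / p a) ^ s * (1 - 2 * ratio a) + ratio a"
        by (simp add: cut_value_def algebra_simps)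
      then show False using res min[OF a(1)] by simp
    qed
    have "p a > 2" using ar primes_sorted primes_prime(1) r45 prime_ge_2_nat[of "p 1"] by auto
    then have eq: "U = high a \<and> V = cone n (cofactor a)"
      using single(3)[OF s_eq] min[OF a(1)] by simp
    \<comment> \<open>With exponent one the last prime would do strictly better by
      \<open>single_layer_bound\<close>.\<close>
    have "m a > 1" if "a = r - 1"
    proof (rule ccontr)
      assume "\<not> m a > 1"
      then have "m a = 1" using exponent[OF a(1)] by simp
      moreover have "1 / p r + (1 - 2 * (1 / p r)) * ratio r < 1 / p a + (1 - 2 * (1 / p a)) * ratio a"
        using that a(1) half by (intro single_layer_bound) auto
      ultimately show False
        using min[OF r_mem(1)] res unfolding cut_value_last s_eq by (simp add: algebra_simps)
    qed
    then show ?thesis using ar eq by auto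
  qed
qed

end

end

end

section \<open>Cut-sets of the power graph of a cyclic group\<close>

locale finite_cyclic_group = group G for G (structure) +
  fixes n :: nat
  assumes cyclic: "cyclic_group G" and order_eq: "order G = n" and order_pos: "n > 0"
begin

definition ord_set :: "nat set \<Rightarrow> 'a set" where
  "ord_set S = {x \<in> carrier G. ord x \<in> S}"

lemma fin: "finite (carrier G)"
  using order_eq order_pos order_gt_0_iff_finite by simp

lemma ord_dvd: "x \<in> carrier G \<Longrightarrow> ord x dvd n"
  using ord_dvd_group_order order_eq by simp

text \<open>For a generator \<open>g\<close>, the power \<open>g [^] k\<close> has order
  \<open>n div gcd k n\<close>, so it suffices to count the \<open>k\<close> with
  \<open>gcd k n = n div d\<close>.\<close>

lemma card_ord_eq:
  assumes "d dvd n"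
  shows "card {x \<in> carrier G. ord x = d} = totient d"
proof -
  obtain d' where d': "n = d * d'" using assms by auto
  then have pos: "d > 0" "d' > 0" using order_pos by auto
  obtain g where g: "g \<in> carrier G" "subgroup_generated G {g} = G"
    using cyclic unfolding cyclic_group_def by blast
  have ord_g: "ord g = n" using cyclic_order_is_ord[OF g(1)] g(2) order_eq by simp
  have inj: "inj_on (\<lambda>k. g [^] k) {1..n}" using ord_inj'[OF g(1)] ord_g by simp
  have img: "(\<lambda>k. g [^] k) ` {1..n} = carrier G"
  proof (rule card_subset_eq[OF fin])
    show "(\<lambda>k. g [^] k) ` {1..n} \<subseteq> carrier G" using g by auto
    show "card ((\<lambda>k. g [^] k) ` {1..n}) = card (carrier G)"
      using card_image[OF inj] order_eq by (simp add: order_def)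
  qed
  have "{x \<in> carrier G. ord x = d} = (\<lambda>k. g [^] k) ` {k \<in> {1..n}. ord (g [^] k) = d}"
    unfolding img[symmetric] by auto
  moreover have "inj_on (\<lambda>k. g [^] k) {k \<in> {1..n}. ord (g [^] k) = d}"
    by (rule inj_on_subset[OF inj]) auto
  ultimately have "card {x \<in> carrier G. ord x = d} = card {k \<in> {1..n}. ord (g [^] k) = d}"
    by (simp add: card_image)
  also have "{k \<in> {1..n}. ord (g [^] k) = d} = {k \<in> {0<..n}. gcd k n = d'}"
  proof -
    have "ord (g [^] k) = d \<longleftrightarrow> gcd k n = d'" if "k \<in> {1..n}" for k
    proof -
      have "ord (g [^] k) = n div gcd k n"
        using ord_pow_gen[OF g(1), of k] that ord_g by (simp add: gcd.commute)
      moreover obtain c where c: "n = gcd k n * c" by (rule dvdE[OF gcd_dvd2])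
      moreover have "gcd k n > 0" using order_pos by simp
      moreover have "n div gcd k n = c" using c \<open>gcd k n > 0\<close> by (metis nonzero_mult_div_cancel_left less_irrefl)
      moreover have "c = d \<longleftrightarrow> gcd k n = d'"
      proof
        assume "c = d"
        then have "d * gcd k n = d * d'" using c d' by (metis mult.commute)
        then show "gcd k n = d'" using pos by simp
      next
        assume "gcd k n = d'"
        then have "d' * c = d' * d" using c d' by (metis mult.commute)
        then show "c = d" using pos by simp
      qed
      ultimately show ?thesis by simp
    qed
    then show ?thesis by auto
  qed
  also have "card \<dots> = totient (n div d')"
    using order_pos d' by (intro card_gcd_eq_totient) simp_all
  also have "n div d' = d" using d' pos by simp
  finally show ?thesis .
qed

lemma card_ord_set_sum:
  assumes "S \<subseteq> {d. d dvd n}"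
  shows "card (ord_set S) = (\<Sum>d\<in>S. totient d)"
proof -
  have finS: "finite S" using assms order_pos by (auto intro: finite_subset)
  have "ord_set S = (\<Union>d\<in>S. {x \<in> carrier G. ord x = d})" by (auto simp: ord_set_def)
  also have "card \<dots> = (\<Sum>d\<in>S. card {x \<in> carrier G. ord x = d})"
    using finS fin by (intro card_UN_disjoint) auto
  also have "\<dots> = (\<Sum>d\<in>S. totient d)" using assms by (intro sum.cong card_ord_eq) auto
  finally show ?thesis .
qed

lemma card_ord_set: "S \<subseteq> {d. d dvd n} \<Longrightarrow> real (card (ord_set S)) = real n * prb n S"
  using order_pos by (simp add: card_ord_set_sum prb_def)

lemma card_ord_dvd: "d dvd n \<Longrightarrow> card {x \<in> carrier G. ord x dvd d} = d"
  using card_ord_set_sum[of "{e. e dvd d}"] by (auto simp: ord_set_def totient_divisor_sum intro: dvd_trans)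

text \<open>One inclusion holds, and both sets have \<open>ord x\<close> elements.\<close>

lemma generate_eq_ord_dvd:
  assumes "x \<in> carrier G"
  shows "generate G {x} = {y \<in> carrier G. ord y dvd ord x}"
proof (rule card_subset_eq)
  show "finite {y \<in> carrier G. ord y dvd ord x}" using fin by simp
  show "generate G {x} \<subseteq> {y \<in> carrier G. ord y dvd ord x}"
  proof
    fix y assume "y \<in> generate G {x}"
    then obtain k :: nat where "y = x [^] k"
      using generate_pow_on_finite_carrier[OF fin assms] by auto
    moreover have "(x [^] k) [^] ord x = \<one>"
      using assms by (simp add: nat_pow_pow mult.commute[of k]) (simp add: nat_pow_pow[symmetric])
    ultimately show "y \<in> {y \<in> carrier G. ord y dvd ord x}" using assms by (simp add: pow_eq_id)
  qed
  show "card (generate G {x}) = card {y \<in> carrier G. ord y dvd ord x}"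
    using generate_pow_card[OF assms] card_ord_dvd[OF ord_dvd[OF assms]] by simp
qed

text \<open>Turns adjacency in the power graph into comparability of orders.\<close>

lemma power_iff_ord_dvd:
  assumes "x \<in> carrier G" "y \<in> carrier G"
  shows "(\<exists>k::nat. y = x [^] k) \<longleftrightarrow> ord y dvd ord x"
  using generate_eq_ord_dvd[OF assms(1)] generate_pow_on_finite_carrier[OF fin assms(1)] assms(2) by auto

text \<open>Elements of a subgroup of order \<open>d\<close> have order dividing \<open>d\<close>,
  and only \<open>d\<close> elements do; this gives the uniqueness behind the description
  operator.\<close>

lemma S_set_eq:
  assumes "d dvd n"
  shows "S_set G d = {x \<in> carrier G. ord x dvd d}"
proof -
  have d: "d > 0" using assms order_pos by (rule dvd_pos_nat[rotated])
  then have "card {x \<in> carrier G. ord x = d} > 0" using card_ord_eq[OF assms] by simp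
  then obtain x where x: "x \<in> carrier G" "ord x = d" by (auto simp: card_gt_0_iff)
  then have sub: "subgroup {x \<in> carrier G. ord x dvd d} G"
    using generate_eq_ord_dvd[OF x(1)] generate_is_subgroup[of "{x}"] by simp
  show ?thesis unfolding S_set_def
  proof (rule the_equality)
    show "subgroup {x \<in> carrier G. ord x dvd d} G \<and> card {x \<in> carrier G. ord x dvd d} = d"
      using sub card_ord_dvd[OF assms] by simp
  next
    fix H assume H: "subgroup H G \<and> card H = d"
    show "H = {x \<in> carrier G. ord x dvd d}"
    proof (rule card_subset_eq)
      show "finite {x \<in> carrier G. ord x dvd d}" using fin by simp
      show "card H = card {x \<in> carrier G. ord x dvd d}" using H card_ord_dvd[OF assms] by simp
      show "H \<subseteq> {x \<in> carrier G. ord x dvd d}"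
      proof
        fix h assume h: "h \<in> H"
        then have hG: "h \<in> carrier G" using H subgroup.subset by blast
        interpret H: group "G\<lparr>carrier := H\<rparr>" using H by (auto intro: subgroup.subgroup_is_group is_group)
        have "h [^] order (G\<lparr>carrier := H\<rparr>) = \<one>"
          using H.pow_order_eq_1[of h] h by (simp add: nat_pow_consistent[symmetric])
        then have "h [^] d = \<one>" using H by (simp add: order_def)
        then show "h \<in> {x \<in> carrier G. ord x dvd d}" using hG by (simp add: pow_eq_id)
      qed
    qed
  qed
qed

text \<open>Disconnectedness is a splitting of the survivors with no comparable orders across. The
  parts are automatically disjoint, since every order divides itself.\<close>

lemma cut_set_iff:
  "cut_set (power_graph G) X \<longleftrightarrow> X \<subseteq> carrier G \<and>
     (\<exists>A B. A \<union> B = carrier G - X \<and> A \<noteq> {} \<and> B \<noteq> {} \<and>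
       (\<forall>x\<in>A. \<forall>y\<in>B. \<not> ord x dvd ord y \<and> \<not> ord y dvd ord x))"
proof -
  define W where "W = carrier G - X"
  \<comment> \<open>\<open>R\<close> turns out to be the arc set of the symmetric closure in terms
    of which connectedness is defined.\<close>
  define R where "R = {(x, y). x \<in> W \<and> y \<in> W \<and> x \<noteq> y \<and> (ord x dvd ord y \<or> ord y dvd ord x)}"
  have W: "W \<subseteq> carrier G" by (auto simp: W_def)
  have ver: "verts (power_graph G) = carrier G" "tail (power_graph G) = fst" "head (power_graph G) = snd"
    by (simp_all add: power_graph_def)
  have arcs: "arcs (power_graph G) =
      {(x, y). x \<in> carrier G \<and> y \<in> carrier G \<and> x \<noteq> y \<and> (ord x dvd ord y \<or> ord y dvd ord x)}"
  proof -
    have "((\<exists>k::nat. y = x [^] k) \<or> (\<exists>k::nat. x = y [^] k)) \<longleftrightarrow> ord x dvd ord y \<or> ord y dvd ord x"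
      if "x \<in> carrier G" "y \<in> carrier G" for x y
      using power_iff_ord_dvd[OF that] power_iff_ord_dvd[OF that(2,1)] by blast
    then show ?thesis unfolding power_graph_def with_proj_simps pair_pre_digraph.simps by blast
  qed
  have "parcs (mk_symmetric (induce_subgraph (power_graph G) W)) =
      (\<Union>e\<in>{e \<in> arcs (power_graph G). fst e \<in> W \<and> snd e \<in> W}. {(fst e, snd e), (snd e, fst e)})"
    by (simp add: mk_symmetric_def induce_subgraph_def ver)
  also have "\<dots> = R"
  proof (intro equalityI subsetI)
    fix e assume "e \<in> R"
    then obtain x y where "e = (x, y)" "(x, y) \<in> R" by (cases e) auto
    then show "e \<in> (\<Union>e\<in>{e \<in> arcs (power_graph G). fst e \<in> W \<and> snd e \<in> W}. {(fst e, snd e), (snd e, fst e)})"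
      unfolding arcs R_def using W by (intro UN_I[of "(x, y)"]) auto
  next
    fix e assume "e \<in> (\<Union>e\<in>{e \<in> arcs (power_graph G). fst e \<in> W \<and> snd e \<in> W}. {(fst e, snd e), (snd e, fst e)})"
    then obtain x y where "(x, y) \<in> arcs (power_graph G)" "x \<in> W" "y \<in> W" "e = (x, y) \<or> e = (y, x)"
      by (elim UN_E) auto
    then show "e \<in> R" unfolding arcs R_def by blast
  qed
  finally have conn: "Digraph_Component.connected (induce_subgraph (power_graph G) W) \<longleftrightarrow>
      W \<noteq> {} \<and> (\<forall>u\<in>W. \<forall>v\<in>W. (u, v) \<in> rtrancl_on W R)"
    unfolding Digraph_Component.connected_def strongly_connected_def reachable_def
    by (simp add: mk_symmetric_def)
  have "(W \<noteq> {} \<and> \<not> Digraph_Component.connected (induce_subgraph (power_graph G) W)) \<longleftrightarrow>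
      (\<exists>A B. A \<union> B = W \<and> A \<noteq> {} \<and> B \<noteq> {} \<and> (\<forall>x\<in>A. \<forall>y\<in>B. \<not> ord x dvd ord y \<and> \<not> ord y dvd ord x))"
    (is "?L \<longleftrightarrow> ?R")
  proof
    assume ?L
    then obtain u v where uv: "u \<in> W" "v \<in> W" "(u, v) \<notin> rtrancl_on W R" using conn by auto
    \<comment> \<open>One side consists of everything reachable from \<open>u\<close>.\<close>
    define A where "A = {w \<in> W. (u, w) \<in> rtrancl_on W R}"
    have "\<not> ord x dvd ord y \<and> \<not> ord y dvd ord x" if "x \<in> A" "y \<in> W - A" for x y
    proof (rule ccontr)
      assume "\<not> ?thesis"
      then have "(x, y) \<in> R" using that unfolding R_def A_def by auto
      then have "y \<in> A" using that unfolding A_def by (auto intro: rtrancl_on_into_rtrancl_on)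
      then show False using that by simp
    qed
    moreover have "u \<in> A" "v \<in> W - A" "A \<union> (W - A) = W" using uv by (auto simp: A_def)
    ultimately show ?R by blast
  next
    assume ?R
    then obtain A B where AB: "A \<union> B = W" "A \<noteq> {}" "B \<noteq> {}"
      "\<And>x y. x \<in> A \<Longrightarrow> y \<in> B \<Longrightarrow> \<not> ord x dvd ord y \<and> \<not> ord y dvd ord x" by blast
    then obtain a b where ab: "a \<in> A" "b \<in> B" by auto
    have "z \<in> A" if "(a, z) \<in> rtrancl_on W R" for z
      using that
    proof (induction rule: rtrancl_on_induct)
      case base
      show ?case by (rule ab)
    next
      case (step y z)
      then have "ord y dvd ord z \<or> ord z dvd ord y" "z \<in> W" by (auto simp: R_def)
      then show ?case using AB step by blast
    qed
    \<comment> \<open>The instance at \<open>b\<close>, \<open>b\<close> excludes that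
      \<open>b\<close> lies on both sides.\<close>
    then have "(a, b) \<notin> rtrancl_on W R" using AB(4)[of b b] ab by auto
    then show ?L using conn AB ab by auto
  qed
  then show ?thesis unfolding cut_set_def ver(1) W_def by auto
qed

section \<open>Minimum cut-sets and optimal pairs of up-sets\<close>

definition pair_cut :: "nat set \<Rightarrow> nat set \<Rightarrow> 'a set" where
  "pair_cut U V = {x \<in> carrier G. ord x \<in> U \<longleftrightarrow> ord x \<in> V}"

lemma pair_cut_commute: "pair_cut U V = pair_cut V U"
  by (auto simp: pair_cut_def)

lemma card_pair_cut:
  assumes "up_set n U" "up_set n V"
  shows "real (card (pair_cut U V)) = real n * residual n U V"
proof -
  let ?S = "(U - V) \<union> (V - U)"
  have S: "?S \<subseteq> {d. d dvd n}" using assms by (auto simp: up_set_def)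
  have "pair_cut U V = carrier G - ord_set ?S" by (auto simp: pair_cut_def ord_set_def)
  moreover have "ord_set ?S \<subseteq> carrier G" by (auto simp: ord_set_def)
  ultimately have "real (card (pair_cut U V)) = real n - real (card (ord_set ?S))"
    using fin order_eq card_mono[of "carrier G" "ord_set ?S"]
    by (simp add: card_Diff_subset finite_subset order_def of_nat_diff)
  also have "\<dots> = real n * (1 - prb n ?S)"
    unfolding card_ord_set[OF S] by (simp add: algebra_simps)
  also have "\<dots> = real n * residual n U V"
    using assms order_pos by (simp add: residual_symdiff finite_up_set)
  finally show ?thesis .
qed

text \<open>The survivors have orders in \<open>U - V\<close> or \<open>V - U\<close>; if an order
  on one side divided one on the other, the larger would lie in both up-sets.\<close>

lemma cut_set_pair_cut:
  assumes "incomparable n U V"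
  shows "cut_set (power_graph G) (pair_cut U V)"
  unfolding cut_set_iff
proof (intro conjI exI)
  have up: "up_set n U" "up_set n V" and ne: "\<not> U \<subseteq> V" "\<not> V \<subseteq> U"
    using assms by (auto simp: incomparable_def)
  show "pair_cut U V \<subseteq> carrier G" by (auto simp: pair_cut_def)
  show "ord_set (U - V) \<union> ord_set (V - U) = carrier G - pair_cut U V"
    by (auto simp: pair_cut_def ord_set_def)
  have ne': "ord_set S \<noteq> {}" if "d \<in> S" "d dvd n" for d S
  proof -
    have "card {x \<in> carrier G. ord x = d} > 0"
      using card_ord_eq[OF that(2)] that(2) order_pos by (auto intro: dvd_pos_nat)
    then show ?thesis using that(1) unfolding ord_set_def card_gt_0_iff by auto
  qed
  obtain d where "d \<in> U - V" using ne by auto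
  then show "ord_set (U - V) \<noteq> {}" using up by (intro ne'[of d]) (auto simp: up_set_def)
  obtain d where "d \<in> V - U" using ne by auto
  then show "ord_set (V - U) \<noteq> {}" using up by (intro ne'[of d]) (auto simp: up_set_def)
  show "\<forall>x\<in>ord_set (U - V). \<forall>y\<in>ord_set (V - U). \<not> ord x dvd ord y \<and> \<not> ord y dvd ord x"
  proof (intro ballI)
    fix x y assume "x \<in> ord_set (U - V)" "y \<in> ord_set (V - U)"
    then have "ord x \<in> U" "ord x \<notin> V" "ord y \<in> V" "ord y \<notin> U" "ord x dvd n" "ord y dvd n"
      using ord_dvd by (auto simp: ord_set_def)
    then show "\<not> ord x dvd ord y \<and> \<not> ord y dvd ord x" using up unfolding up_set_def by blast
  qed
qed

text \<open>Close the orders on each side of the splitting upward. Neither closure meets the orders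
  of the other side, so the pair is incomparable and its cut lies inside \<open>X\<close>;
  minimality yields equality and optimality.\<close>

lemma minimum_cut_set_pair:
  assumes "minimum_cut_set (power_graph G) X"
  obtains U V where "optimal n U V" "X = pair_cut U V"
proof -
  have cut: "cut_set (power_graph G) X" and min: "\<And>Y. cut_set (power_graph G) Y \<Longrightarrow> card X \<le> card Y"
    using assms by (auto simp: minimum_cut_set_def)
  obtain A B where AB: "A \<union> B = carrier G - X" "A \<noteq> {}" "B \<noteq> {}"
    "\<And>x y. x \<in> A \<Longrightarrow> y \<in> B \<Longrightarrow> \<not> ord x dvd ord y \<and> \<not> ord y dvd ord x" and X: "X \<subseteq> carrier G"
    using cut unfolding cut_set_iff by blast
  define up where "up A = {e. e dvd n \<and> (\<exists>a\<in>A. ord a dvd e)}" for A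
  have up_set: "up_set n (up A)" for A
    unfolding up_set_def
  proof (intro conjI subsetI ballI allI impI)
    fix d assume "d \<in> up A"
    then show "d \<in> {d. d dvd n}" by (simp add: up_def)
  next
    fix d e assume de: "d \<in> up A" "d dvd e" "e dvd n"
    then obtain a where "a \<in> A" "ord a dvd d" by (auto simp: up_def)
    then show "e \<in> up A" using de dvd_trans[OF _ de(2)] unfolding up_def by blast
  qed
  have carrier: "a \<in> carrier G" if "a \<in> A \<union> B" for a using that AB(1) by auto
  have A: "ord a \<in> up A" if "a \<in> A" for a
    using that ord_dvd[OF carrier[of a]] unfolding up_def by (auto intro!: bexI[of _ a])
  have B: "ord b \<in> up B" if "b \<in> B" for b
    using that ord_dvd[OF carrier[of b]] unfolding up_def by (auto intro!: bexI[of _ b])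
  have A': "ord a \<notin> up B" if "a \<in> A" for a
    using AB(4)[OF that] unfolding up_def by auto
  have B': "ord b \<notin> up A" if "b \<in> B" for b
    using AB(4)[OF _ that] unfolding up_def by auto
  have inc: "incomparable n (up A) (up B)"
    using AB(2,3) A B A' B' up_set unfolding incomparable_def by blast
  have sub: "pair_cut (up A) (up B) \<subseteq> X"
  proof
    fix x assume "x \<in> pair_cut (up A) (up B)"
    then have x: "x \<in> carrier G" "ord x \<in> up A \<longleftrightarrow> ord x \<in> up B" by (auto simp: pair_cut_def)
    then have "x \<notin> A" "x \<notin> B" using A B A' B' by blast+
    then show "x \<in> X" using x(1) AB(1) by blast
  qed
  have "X = pair_cut (up A) (up B)"
    using card_seteq[OF finite_subset[OF X fin] sub] min[OF cut_set_pair_cut[OF inc]] by simp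
  moreover have "optimal n (up A) (up B)"
    unfolding optimal_def
  proof (intro conjI allI impI)
    fix U V assume UV: "incomparable n U V"
    then have "real (card (pair_cut (up A) (up B))) \<le> real (card (pair_cut U V))"
      using min[OF cut_set_pair_cut[OF UV]] \<open>X = _\<close> by simp
    then have "real n * residual n (up A) (up B) \<le> real n * residual n U V"
      using card_pair_cut[of U V] card_pair_cut[of "up A" "up B"] UV inc
      unfolding incomparable_def by linarith
    then show "residual n (up A) (up B) \<le> residual n U V" using order_pos by simp
  qed (rule inc)
  ultimately show thesis using that by blast
qed

text \<open>Leaving a single vertex takes \<open>n - 1\<close> removals, and a cut-set never has
  more elements because some vertex survives it.\<close>

lemma vertex_connectivity_eq:
  assumes "minimum_cut_set (power_graph G) X"
  shows "vertex_connectivity (power_graph G) = card X"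
  unfolding vertex_connectivity_def
proof (rule Least_equality)
  have cut: "cut_set (power_graph G) X" and min: "\<And>Y. cut_set (power_graph G) Y \<Longrightarrow> card X \<le> card Y"
    using assms by (auto simp: minimum_cut_set_def)
  have ver: "verts (power_graph G) = carrier G" by (simp add: power_graph_def)
  show "\<exists>Y\<subseteq>verts (power_graph G). card Y = card X \<and>
      (cut_set (power_graph G) Y \<or> card (verts (power_graph G) - Y) = 1)"
    using cut by (auto simp: cut_set_def)
  fix k assume "\<exists>Y\<subseteq>verts (power_graph G). card Y = k \<and>
      (cut_set (power_graph G) Y \<or> card (verts (power_graph G) - Y) = 1)"
  then obtain Y where Y: "Y \<subseteq> carrier G" "card Y = k"
    "cut_set (power_graph G) Y \<or> card (carrier G - Y) = 1" unfolding ver by auto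
  have X: "X \<subset> carrier G" using cut by (auto simp: cut_set_def ver)
  then have "card X < card (carrier G)" using fin by (rule psubset_card_mono[rotated])
  moreover have "card (carrier G) = card Y + card (carrier G - Y)"
    using Y(1) fin by (metis card_Un_disjoint Diff_disjoint Diff_partition finite_Diff finite_subset)
  ultimately show "card X \<le> k" using Y min by auto
qed

end

section \<open>Canonical cuts identified with the named sets, and their sizes\<close>

locale finite_cyclic_prime_product = finite_cyclic_group G n + prime_product p m r n
  for G (structure) and p m :: "nat \<Rightarrow> nat" and r n :: nat
begin

text \<open>Orders in both up-sets are the proper multiples of the cofactor, giving the
  \<open>E_set\<close> classes; orders in neither are its proper divisors, giving
  \<open>Q_set\<close>.\<close>

lemma Z_set_eq:
  assumes "a \<in> {1..r}"
  shows "Z_set G p r a (m a) = pair_cut (high a) (cone n (cofactor a))"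
proof -
  define M where "M = cofactor a"
  have M: "n = M * p a ^ m a" "M > 0" using n_split[OF assms] cofactor_pos[OF assms] by (auto simp: M_def)
  have pa: "p a > 0" using p_pos[OF assms] .
  have powers: "E_set G (n div p a ^ j) = {x \<in> carrier G. ord x = M * p a ^ (m a - j)}" if "j < m a" for j
  proof -
    have "n = M * p a ^ (m a - j) * p a ^ j" using that M(1) by (simp add: power_add[symmetric] mult.assoc)
    then show ?thesis using pa by (simp add: E_set_def)
  qed
  have quot: "S_set G (n div (p i * p a ^ m a)) = {x \<in> carrier G. p i * ord x dvd M}"
    if i: "i \<in> {1..r} - {a}" for i
  proof -
    have "p i dvd p i ^ m i" using exponent[of i] i by (intro dvd_power) auto
    also have "\<dots> dvd M" unfolding M_def cofactor_def using i by (intro dvd_prodI) auto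
    finally obtain e where e: "M = p i * e" by auto
    have pi: "p i > 0" using p_pos[of i] i by simp
    have n_e: "n = e * (p i * p a ^ m a)" using M(1) e by simp
    then have "n div (p i * p a ^ m a) = e" using pi pa by simp
    then show ?thesis using S_set_eq[of e] n_e pi e by simp
  qed
  have Q: "Q_set G p r a (m a) = {x \<in> carrier G. ord x dvd M \<and> ord x \<noteq> M}"
  proof (intro equalityI subsetI)
    fix x assume "x \<in> Q_set G p r a (m a)"
    then obtain i where "i \<in> {1..r} - {a}" "x \<in> S_set G (n div (p i * p a ^ m a))"
      unfolding Q_set_def order_eq by blast
    then have i: "i \<in> {1..r} - {a}" "x \<in> carrier G" "p i * ord x dvd M"
      using quot by blast+
    have "p i > 1" using prime_gt_1_nat[OF prime] i by simp
    then have "ord x \<noteq> M" using i(3) M(2) by (auto dest!: dvd_imp_le)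
    then show "x \<in> {x \<in> carrier G. ord x dvd M \<and> ord x \<noteq> M}" using i by (auto dest: dvd_mult_right)
  next
    fix x assume x: "x \<in> {x \<in> carrier G. ord x dvd M \<and> ord x \<noteq> M}"
    then obtain c where c: "M = ord x * c" by auto
    then have "c \<noteq> 1" using x by auto
    \<comment> \<open>A prime factor of \<open>M / ord x\<close> selects a subgroup in the union
      that contains \<open>x\<close>.\<close>
    then obtain q where q: "prime q" "q dvd c" using prime_factor_nat by blast
    have "q * ord x dvd M" using q(2) c by (simp add: mult.commute)
    have "q dvd M" using q(2) c by simp
    then have "q dvd n" using M(1) by simp
    then obtain i where i: "i \<in> {1..r}" "q = p i" using prime_factor_index q(1) by blast
    have "i \<noteq> a"
    proof
      assume "i = a"
      then have "p a dvd M" using \<open>q dvd M\<close> i(2) by simp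
      moreover have "coprime M (p a)" unfolding M_def using coprime_cofactor[OF assms, of 1] by simp
      ultimately have "p a dvd 1" by (meson coprime_common_divisor dvd_refl)
      then show False using prime_gt_1_nat[OF prime[OF assms]] by simp
    qed
    then show "x \<in> Q_set G p r a (m a)"
      unfolding Q_set_def order_eq using quot[of i] i \<open>q * ord x dvd M\<close> x by auto
  qed
  have E: "(\<Union>j<m a. E_set G (n div p a ^ j)) = {x \<in> carrier G. M dvd ord x \<and> ord x \<noteq> M}"
  proof (intro equalityI subsetI)
    fix x assume "x \<in> (\<Union>j<m a. E_set G (n div p a ^ j))"
    then obtain j where j: "j < m a" "x \<in> carrier G" "ord x = M * p a ^ (m a - j)" using powers by auto
    have "p a ^ (m a - j) > 1"
      using prime_gt_1_nat[OF prime[OF assms]] j(1) by (intro one_less_power) auto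
    then show "x \<in> {x \<in> carrier G. M dvd ord x \<and> ord x \<noteq> M}" using j M(2) by (auto simp del: power_eq_1_iff)
  next
    fix x assume x: "x \<in> {x \<in> carrier G. M dvd ord x \<and> ord x \<noteq> M}"
    then obtain e where e: "ord x = M * e" by auto
    then have "M * e dvd M * p a ^ m a" using ord_dvd[of x] x M(1) by simp
    then have "e dvd p a ^ m a" using M(2) by simp
    then obtain k where k: "e = p a ^ k" "k \<le> m a" using prime[OF assms] by (auto simp: divides_primepow_nat)
    then have "k > 0" using x e by (cases k) auto
    then have j: "m a - k < m a" "m a - (m a - k) = k" using k by auto
    then have "x \<in> E_set G (n div p a ^ (m a - k))" using powers[of "m a - k"] x e k by simp
    then show "x \<in> (\<Union>j<m a. E_set G (n div p a ^ j))" using j(1) by blast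
  qed
  have "ord x \<in> high a \<longleftrightarrow> \<not> ord x dvd M" "ord x \<in> cone n (cofactor a) \<longleftrightarrow> M dvd ord x"
    if "x \<in> carrier G" for x
    using ord_dvd[OF that] by (auto simp: M_def cone_def)
  then show ?thesis
    unfolding Z_set_def order_eq E Q pair_cut_def by (auto dest: dvd_antisym)
qed

text \<open>Since ratios ignore exponents, the totient in \<open>beta\<close> is
  \<open>ratio a * R\<close>, and both sides become the same rational expression.\<close>

lemma beta_eq:
  assumes "a \<in> {1..r}"
  shows "beta n p r a (m a) = real n * cut_value a"
proof -
  define R where "R = (\<Prod>i\<in>{1..r} - {a}. p i)"
  \<comment> \<open>Setting all exponents to one describes the radical of \<open>n\<close>.\<close>
  interpret rad: prime_product p "\<lambda>_. 1" r "\<Prod>i=1..r. p i ^ 1"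
    by unfold_locales (use prime mono in auto)
  have R: "R = rad.cofactor a" unfolding R_def rad.cofactor_def by simp
  have Rpos: "R > 0" unfolding R by (rule rad.cofactor_pos[OF assms])
  have rad: "(\<Prod>i=1..r. p i) = p a * R" unfolding R_def using assms by (simp add: prod.remove)
  have "rad.ratio a = ratio a" unfolding rad.ratio_eq[OF assms] ratio_eq[OF assms] ..
  then have totR: "real (totient R) = ratio a * R" using Rpos unfolding rad.ratio_def R[symmetric] by (simp add: field_simps)
  have pa: "p a > 0" using p_pos[OF assms] .
  obtain k where k: "m a = Suc k" using exponent[OF assms] by (cases "m a") auto
  have n: "real n = real (cofactor a) * real (p a) * real (p a) ^ k"
    using n_split[OF assms] unfolding k by (metis of_nat_mult of_nat_power power_Suc mult.assoc)
  have totn: "real (totient n) = real n * (ratio a * (1 - 1 / p a))"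
    using totient_ratio[OF assms] order_pos by (simp add: field_simps)
  have "(\<Prod>i=1..r. p i) div p a = R" using rad pa by simp
  then have "beta n p r a (m a) = real n * (ratio a * (1 - 1 / p a)) +
      real n / (real (p a) * real R) * (1 / real (p a) ^ k) * (real R + ratio a * real R * (real (p a) ^ k - 2))"
    unfolding beta_def totn using rad totR k pa by simp
  also have "\<dots> = real n * cut_value a"
    unfolding n cut_value_def k using pa Rpos by (simp add: field_simps)
  finally show ?thesis .
qed

lemma minimum_cut_set_cases:
  assumes "r \<in> {4, 5}" "ratio r < 1 / 2" "m r = 1" "r = 5 \<Longrightarrow> p 1 = 3"
    and X: "minimum_cut_set (power_graph G) X"
  obtains a where "a = r \<or> a = r - 1 \<and> m a > 1" "X = Z_set G p r a (m a)"
    "real (vertex_connectivity (power_graph G)) = beta n p r a (m a)"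
proof -
  have r: "r \<in> {1..r}" "r - 1 \<in> {1..r}" "r \<ge> 2" using assms(1) by auto
  obtain U V where UV: "optimal n U V" "X = pair_cut U V" by (rule minimum_cut_set_pair[OF X])
  have up: "up_set n U" "up_set n V" using UV(1) by (auto simp: optimal_def incomparable_def)
  have "1 < p 1" "p 1 < p r" using prime_gt_1_nat[OF prime[of 1]] p_less[of 1 r] assms(1) by auto
  \<comment> \<open>This product is \<open>1 / 2 - cut_value r\<close>, so an optimal residual is
    below one half, and so is the probability of one of \<open>U\<close>, \<open>V\<close>.\<close>
  then have "0 < (1 / 2 - ratio r) * (1 - 2 * (1 / p r))"
    using assms(2) by (intro mult_pos_pos) (auto simp: field_simps)
  also have "\<dots> = 1 / 2 - cut_value r"
    using assms(3) by (simp add: cut_value_def algebra_simps)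
  finally have "residual n U V < 1 / 2"
    using UV(1) canonical_pair[OF r(1,3)] unfolding optimal_def by fastforce
  then have "prb n U < 1 / 2 \<or> prb n V < 1 / 2"
    by (rule residual_less_half[OF order_pos up])
  then obtain a where a: "a = r \<or> a = r - 1 \<and> m a > 1" "X = pair_cut (high a) (cone n (cofactor a))"
  proof
    assume "prb n V < 1 / 2"
    from optimal_classification[OF assms(1-4) UV(1) this] show thesis
      using that UV(2) by blast
  next
    assume "prb n U < 1 / 2"
    from optimal_classification[OF assms(1-4) UV(1)[unfolded optimal_commute[of n U V]] this] show thesis
      using that UV(2) pair_cut_commute by metis
  qed
  then have ar: "a \<in> {1..r}" using r by auto
  have "real (card X) = real n * cut_value a"
    unfolding a(2) using canonical_pair[OF ar r(3)] by (simp add: card_pair_cut incomparable_def)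
  then show thesis
    using that[OF a(1)] a(2) Z_set_eq[OF ar] beta_eq[OF ar] vertex_connectivity_eq[OF X] by simp
qed

end

text \<open>Translates the totient hypothesis, which concerns the product of the primes without
  exponents, into a bound on \<open>ratio r\<close>.\<close>

lemma prime_product_ratio_totient:
  assumes "prime_product p m r n" "r > 0"
  shows "prime_product.ratio p m r r =
    totient (\<Prod>i=1..r-1. p i) / (\<Prod>i=1..r-1. p i)"
proof -
  interpret prime_product p m r n by fact
  interpret rad: prime_product p "\<lambda>_. 1" r "\<Prod>i=1..r. p i ^ 1"
    by unfold_locales (use prime mono in auto)
  have r: "r \<in> {1..r}" using assms(2) by simp
  have "{1..r} - {r} = {1..r - 1}" using assms(2) by auto
  then have "rad.cofactor r = (\<Prod>i=1..r-1. p i)" unfolding rad.cofactor_def by simp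
  moreover have "rad.ratio r = ratio r" unfolding rad.ratio_eq[OF r] ratio_eq[OF r] ..
  ultimately show ?thesis unfolding rad.ratio_def by simp
qed

theorem theorem1p4:
  fixes G :: "('a, 'b) monoid_scheme"
    and n r :: nat
    and p m :: "nat \<Rightarrow> nat"
    and X :: "'a set"
  assumes "group G" and "cyclic_group G" and "order G = n"
    and "\<And>i. i \<in> {1..r} \<Longrightarrow> prime (p i)"
    and "strict_mono_on {1..r} p"
    and "\<And>i. i \<in> {1..r} \<Longrightarrow> m i > 0"
    and "n = (\<Prod>i=1..r. p i ^ m i)"
    and "r \<in> {4, 5}"
    and "m r = 1"
    and "2 * totient (\<Prod>i=1..r-1. p i) < (\<Prod>i=1..r-1. p i)"
    and "minimum_cut_set (power_graph G) X"
  shows "p 1 \<in> {2, 3} \<and>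
    (r = 4 \<longrightarrow>
       X \<in> {Z_set G p r 3 (m 3), Z_set G p r 4 1} \<and>
       real (vertex_connectivity (power_graph G)) \<in> {beta n p r 3 (m 3), beta n p r 4 1} \<and>
       (m 3 = 1 \<longrightarrow>
          X = Z_set G p r 4 1 \<and>
          real (vertex_connectivity (power_graph G)) = beta n p r 4 1)) \<and>
    (r = 5 \<and> p 1 = 3 \<longrightarrow>
       X \<in> {Z_set G p r 4 (m 4), Z_set G p r 5 1} \<and>
       real (vertex_connectivity (power_graph G)) \<in> {beta n p r 4 (m 4), beta n p r 5 1} \<and>
       (m 4 = 1 \<longrightarrow>
          X = Z_set G p r 5 1 \<and>
          real (vertex_connectivity (power_graph G)) = beta n p r 5 1))"
proof -
  interpret prime_product p m r n by unfold_locales (use assms in auto)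
  have fc: "finite_cyclic_prime_product G p m r n"
    using assms(1-3) n_pos prime_product_axioms
    unfolding finite_cyclic_prime_product_def finite_cyclic_group_def finite_cyclic_group_axioms_def by blast
  have "(\<Prod>i=1..r-1. p i) > 0" using assms(10) by linarith
  moreover have "real (2 * totient (\<Prod>i=1..r-1. p i)) < real (\<Prod>i=1..r-1. p i)"
    using assms(10) by (simp only: of_nat_less_iff)
  ultimately have "real (totient (\<Prod>i=1..r-1. p i)) / real (\<Prod>i=1..r-1. p i) < 1 / 2"
    by (simp add: divide_less_eq)
  then have half: "ratio r < 1 / 2"
    using prime_product_ratio_totient[OF prime_product_axioms] assms(8) by auto
  \<comment> \<open>For \<open>r = 4\<close> the condition
    \<open>r = 5 \<Longrightarrow> p 1 = 3\<close> holds vacuously, so one statement serves both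
    cases.\<close>
  have cases: "\<exists>a. (a = r \<or> a = r - 1 \<and> m a > 1) \<and> X = Z_set G p r a (m a) \<and>
      real (vertex_connectivity (power_graph G)) = beta n p r a (m a)" if "r = 4 \<or> p 1 = 3"
  proof -
    have "r = 5 \<Longrightarrow> p 1 = 3" using that by auto
    from finite_cyclic_prime_product.minimum_cut_set_cases[OF fc assms(8) half assms(9) this assms(11)]
    show ?thesis by blast
  qed
  have m4: "m 4 = 1" if "r = 4" using assms(9) that by simp
  have m5: "m 5 = 1" if "r = 5" using assms(9) that by simp
  show ?thesis
  proof (intro conjI[of "p 1 \<in> {2, 3}"] conjI[of "r = 4 \<longrightarrow> _"] impI)
    show "p 1 \<in> {2, 3}" by (rule first_prime[OF assms(8) half])
  next
    assume r: "r = 4"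
    obtain a where a: "a = 4 \<or> a = 3 \<and> m 3 > 1" "X = Z_set G p r a (m a)"
      "real (vertex_connectivity (power_graph G)) = beta n p r a (m a)"
      using cases r by auto
    show "X \<in> {Z_set G p r 3 (m 3), Z_set G p r 4 1} \<and>
       real (vertex_connectivity (power_graph G)) \<in> {beta n p r 3 (m 3), beta n p r 4 1} \<and>
       (m 3 = 1 \<longrightarrow> X = Z_set G p r 4 1 \<and>
          real (vertex_connectivity (power_graph G)) = beta n p r 4 1)"
      using a(1)
    proof
      assume "a = 4"
      then show ?thesis using a(2,3) unfolding \<open>a = 4\<close> m4[OF r] by blast
    next
      assume "a = 3 \<and> m 3 > 1"
      then show ?thesis using a(2,3) by (elim conjE) (simp only: insert_iff less_irrefl simp_thms refl, simp)
    qed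
  next
    assume r: "r = 5 \<and> p 1 = 3"
    then have r5: "r = 5" by simp
    obtain a where a: "a = 5 \<or> a = 4 \<and> m 4 > 1" "X = Z_set G p r a (m a)"
      "real (vertex_connectivity (power_graph G)) = beta n p r a (m a)"
      using cases r by auto
    show "X \<in> {Z_set G p r 4 (m 4), Z_set G p r 5 1} \<and>
       real (vertex_connectivity (power_graph G)) \<in> {beta n p r 4 (m 4), beta n p r 5 1} \<and>
       (m 4 = 1 \<longrightarrow> X = Z_set G p r 5 1 \<and>
          real (vertex_connectivity (power_graph G)) = beta n p r 5 1)"
      using a(1)
    proof
      assume "a = 5"
      then show ?thesis using a(2,3) unfolding \<open>a = 5\<close> m5[OF r5] by blast
    next
      assume "a = 4 \<and> m 4 > 1"
      then show ?thesis using a(2,3) by (elim conjE) (simp only: insert_iff less_irrefl simp_thms refl, simp)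
    qed
  qed
qed

end
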